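(* There exist constants $c>0$ and $p_0$ such that for every prime $p\ge p_0$ and all pairwise distinct non-zero elements $a_1,a_2,a_3\in\mathbb{F}_p$, the number $N(a_1,a_2,a_3;p)$ of tuples $(\alpha_1,\alpha_2,\alpha_3,\beta)$ of primitive roots modulo $p$ satisfying $$\alpha_1+\beta\equiv a_1,\quad \alpha_2+\beta\equiv a_2,\quad \alpha_3+\beta\equiv a_3 \pmod p$$ satisfies $$N(a_1,a_2,a_3;p)\ge c\,\frac{p}{(\log\log p)^{4}}.$$ In particular, for every sufficiently large prime $p$ and all pairwise distinct non-zero $a,b,c'\in\mathbb{F}_p$ there exist primitive roots $\alpha,\beta,\gamma,\delta$ modulo $p$ with $\alpha+\delta\equiv a$, $\beta+\delta\equiv b$, $\gamma+\delta\equiv c' \pmod p$.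
   Context: $\mathbb{F}_p$ is the field with $p$ elements, identified with the residue classes modulo $p$. Primitive roots modulo $p$ are counted as residue classes modulo $p$, i.e. they are the generators of the multiplicative group $\mathbb{F}_p^\times$. $\log$ is the natural logarithm. *)

theory Defs
  imports Complex_Main "HOL-Number_Theory.Number_Theory"
begin

text \<open>
  For a prime \<open>p\<close>, an element of the field with \<open>p\<close> elements is represented by its least
  nonnegative residue, so that counting natural numbers below \<open>p\<close> counts residue classes.
\<close>

definition primitive_roots :: "nat \<Rightarrow> nat set" where
  "primitive_roots p = {g \<in> {..<p}. residue_primroot p g}"

definition primroot_tuples :: "nat \<Rightarrow> nat \<Rightarrow> nat \<Rightarrow> nat \<Rightarrow> (nat \<times> nat \<times> nat \<times> nat) set" where
  "primroot_tuples a1 a2 a3 p =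
     {(\<alpha>1, \<alpha>2, \<alpha>3, \<beta>).
        \<alpha>1 \<in> primitive_roots p \<and> \<alpha>2 \<in> primitive_roots p \<and>
        \<alpha>3 \<in> primitive_roots p \<and> \<beta> \<in> primitive_roots p \<and>
        [\<alpha>1 + \<beta> = a1] (mod p) \<and> [\<alpha>2 + \<beta> = a2] (mod p) \<and> [\<alpha>3 + \<beta> = a3] (mod p)}"

definition num_primroot_tuples :: "nat \<Rightarrow> nat \<Rightarrow> nat \<Rightarrow> nat \<Rightarrow> nat" where
  "num_primroot_tuples a1 a2 a3 p = card (primroot_tuples a1 a2 a3 p)"

end

theory Submission
  imports Defs "HOL-Computational_Algebra.Polynomial" "HOL-Real_Asymp.Real_Asymp"
begin

text \<open>
  Write \<open>\<alpha>\<^sub>i = a\<^sub>i - \<beta>\<close>. The task is to find many \<open>\<beta>\<close> for which the four values \<open>\<beta>\<close>, \<open>a\<^sub>1 - \<beta>\<close>, \<open>a\<^sub>2 - \<beta>\<close>,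
  \<open>a\<^sub>3 - \<beta>\<close> have discrete logarithms coprime to \<open>p - 1\<close>. The prime divisors \<open>l\<close> of \<open>p - 1\<close> are sieved
  in three ranges. Those up to \<open>ln p / 100\<close> have a product \<open>d \<le> p powr (1 / 50)\<close>, so small that the
  logarithms of the four values are jointly equidistributed modulo \<open>d\<close>; this leaves a proportion
  of about \<open>(\<phi>(d) / d)^4\<close> of all \<open>\<beta>\<close>, which Mertens' estimates (lemma \<open>totient_ratio_lower\<close>) bound below
  by \<open>c / (ln ln p)^4\<close>. For \<open>l \<le> (ln p)^2\<close> equidistribution modulo \<open>d * l\<close> shows that \<open>l\<close> destroys only a
  fraction \<open>O(1 / l)\<close> of what is left, and since \<open>p - 1\<close> has few prime divisors these fractions sum to
  little. The remaining \<open>l\<close> are so large that the trivial bound \<open>p / l\<close> suffices (lemma \<open>sieve\<close>).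

  Equidistribution modulo such a small number \<open>D\<close> needs neither characters nor Weil's theorem. For each
  of the \<open>D^4\<close> tuples of residue classes, Stepanov's method (lemma \<open>stepanov\<close>) gives the upper bound
  \<open>p / D^4\<close>, up to a relative error \<open>5 / D^12\<close>, for the number of \<open>\<beta>\<close>. The tuples together account for all but four \<open>\<beta>\<close>,
  so the upper bounds for the tuples outside a set imply a lower bound for that set
  (lemma \<open>class_lower\<close>).

  Stepanov's auxiliary polynomial is a combination, with coefficients of low degree, of the products
  \<open>(\<Prod>i. (x - a\<^sub>i)^(g * j\<^sub>i)) * (x - b)^(p * m)\<close>, where \<open>g = (p - 1) / D\<close> and \<open>0 \<le> j\<^sub>i < D\<close>. The crux is
  that it is not zero, i.e. that products of the radicals \<open>(x - a\<^sub>i)^g\<close> are linearly independent over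
  polynomials of low degree, even to high order at one point (lemma \<open>radical_products_independent\<close>).
  That proof is by induction on the number of radicals. A relation between \<open>n\<close> products that holds to
  high order at \<open>b\<close> produces a linear differential equation of order below \<open>n\<close>, with polynomial
  coefficients, that every one of the \<open>n\<close> products satisfies. At the last point \<open>a\<^sub>k\<close>, however, the
  products with a given exponent \<open>g * j\<close> of \<open>x - a\<^sub>k\<close> are, by the induction hypothesis applied at
  \<open>b = a\<^sub>k\<close>, independent to order below \<open>g\<close>, so their combinations show as many different orders of
  vanishing in \<open>{g * j..<g * (j + 1)}\<close> as there are such products. Altogether these are \<open>n\<close> different
  exponents, which is more than the indicial polynomial of the equation has roots modulo \<open>p\<close>.

  Since \<open>p\<close> varies, polynomials over the field with \<open>p\<close> elements are represented by integer
  polynomials, considered modulo \<open>p\<close>.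
\<close>

section \<open>Integer polynomials modulo a prime\<close>

lemma pcompose_power: "pcompose (f ^ n) g = pcompose f g ^ n"
  for f g :: "'a::comm_semiring_1 poly"
  by (induction n) (simp_all add: pcompose_mult pcompose_1)

definition taylor :: "int \<Rightarrow> nat \<Rightarrow> int poly \<Rightarrow> int" where
  "taylor b i f = coeff (pcompose f [:b, 1:]) i"

lemma taylor_add: "taylor b i (f + g) = taylor b i f + taylor b i g"
  by (simp add: taylor_def pcompose_add)

lemma taylor_diff: "taylor b i (f - g) = taylor b i f - taylor b i g"
  by (simp add: taylor_def pcompose_diff)

lemma taylor_sum: "taylor b i (\<Sum>x\<in>A. f x) = (\<Sum>x\<in>A. taylor b i (f x))"
  by (simp add: taylor_def pcompose_sum coeff_sum)

lemma taylor_smult: "taylor b i (smult c f) = c * taylor b i f"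
  by (simp add: taylor_def pcompose_smult)

lemma taylor_mult: "taylor b i (f * g) = (\<Sum>l\<le>i. taylor b l f * taylor b (i - l) g)"
  by (simp add: taylor_def pcompose_mult coeff_mult)

lemma taylor_0: "taylor b 0 f = poly f b"
  by (simp add: taylor_def coeff_0_power flip: poly_0_coeff_0)
     (simp add: poly_pcompose)

lemma taylor_pderiv: "taylor b i (pderiv f) = of_nat (Suc i) * taylor b (Suc i) f"
proof -
  have "pderiv (pcompose f [:b, 1:]) = pcompose (pderiv f) [:b, 1:]"
    by (simp add: pderiv_pcompose pderiv_pCons)
  then show ?thesis
    by (metis coeff_pderiv taylor_def)
qed

lemma taylor_linear_power: "taylor b i ([:-b, 1:] ^ n) = (if i = n then 1 else 0)"
proof -
  have "pcompose ([:-b, 1:] ^ n) [:b, 1:] = monom 1 n"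
    by (simp add: pcompose_power pcompose_pCons monom_altdef)
  then show ?thesis by (simp add: taylor_def)
qed

lemma degree_taylor_shift: "degree (pcompose (f :: int poly) [:b, 1:]) = degree f"
  by (simp add: degree_pcompose)

lemma taylor_shift_back: "pcompose (pcompose f [:b, 1:]) [:-b, 1:] = (f :: int poly)"
  by (simp flip: pcompose_assoc add: pcompose_pCons)

locale prime_modulus =
  fixes p :: int
  assumes prime_p: "prime p"
begin

text \<open>
  The polynomial is zero over the field with \<open>p\<close> elements.
\<close>

abbreviation null :: "int poly \<Rightarrow> bool" where
  "null f \<equiv> [:p:] dvd f"

definition vanishes :: "int \<Rightarrow> nat \<Rightarrow> int poly \<Rightarrow> bool" where
  "vanishes b K f \<longleftrightarrow> (\<forall>i<K. p dvd taylor b i f)"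

lemma p_gt_1: "p > 1"
  using prime_p prime_gt_1_int by blast

lemma null_taylor: "null f \<Longrightarrow> p dvd taylor b i f"
  unfolding taylor_def using pcompose_mult[of "[:p:]"] const_poly_dvd_iff
  by (metis dvd_def pcompose_const)

lemma null_iff_taylor: "null f \<longleftrightarrow> (\<forall>i. p dvd taylor b i f)"
proof
  assume "\<forall>i. p dvd taylor b i f"
  then have "null (pcompose f [:b, 1:])"
    by (simp add: const_poly_dvd_iff taylor_def)
  then have "null (pcompose (pcompose f [:b, 1:]) [:-b, 1:])"
    by (metis dvd_def pcompose_const pcompose_mult)
  then show "null f" by (simp add: taylor_shift_back)
qed (use null_taylor in blast)

lemma null_poly: "null f \<Longrightarrow> p dvd poly f x"
  using null_taylor[of f x 0] by (simp add: taylor_0)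

lemma vanishes_null: "null f \<Longrightarrow> vanishes b K f"
  by (simp add: vanishes_def null_taylor)

lemma vanishes_0 [simp]: "vanishes b 0 f"
  by (simp add: vanishes_def)

lemma vanishes_mono: "vanishes b K f \<Longrightarrow> L \<le> K \<Longrightarrow> vanishes b L f"
  by (auto simp: vanishes_def)

lemma vanishes_add: "vanishes b K f \<Longrightarrow> vanishes b K g \<Longrightarrow> vanishes b K (f + g)"
  by (simp add: vanishes_def taylor_add)

lemma vanishes_diff: "vanishes b K f \<Longrightarrow> vanishes b K g \<Longrightarrow> vanishes b K (f - g)"
  by (simp add: vanishes_def taylor_diff)

lemma vanishes_sum: "(\<And>x. x \<in> A \<Longrightarrow> vanishes b K (f x)) \<Longrightarrow> vanishes b K (\<Sum>x\<in>A. f x)"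
  by (simp add: vanishes_def taylor_sum dvd_sum)

lemma vanishes_cong_null: "null (f - g) \<Longrightarrow> vanishes b K f \<longleftrightarrow> vanishes b K g"
  using vanishes_diff[of b K f "f - g"] vanishes_add[of b K g "f - g"] vanishes_null[of "f - g"]
  by auto

text \<open>
  Leading Taylor coefficients multiply. Every order of vanishing below is computed in this way.
\<close>

lemma vanishes_mult: "vanishes b e f \<Longrightarrow> vanishes b e' g \<Longrightarrow> vanishes b (e + e') (f * g)"
  unfolding vanishes_def taylor_mult
proof (intro allI impI dvd_sum)
  fix i l assume *: "\<forall>i<e. p dvd taylor b i f" "\<forall>i<e'. p dvd taylor b i g" "i < e + e'" "l \<in> {..i}"
  then have "l < e \<or> i - l < e'" by auto
  then show "p dvd taylor b l f * taylor b (i - l) g" using * by auto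
qed

lemma leading_taylor_mult:
  assumes "vanishes b e f" "vanishes b e' g"
  shows "[taylor b (e + e') (f * g) = taylor b e f * taylor b e' g] (mod p)"
proof -
  have "(\<Sum>l\<in>{..e + e'} - {e}. taylor b l f * taylor b (e + e' - l) g) mod p = 0"
  proof (intro dvd_imp_mod_0 dvd_sum)
    fix l assume "l \<in> {..e + e'} - {e}"
    then have "l < e \<or> e + e' - l < e'" by auto
    then show "p dvd taylor b l f * taylor b (e + e' - l) g"
      using assms by (auto simp: vanishes_def)
  qed
  moreover have "taylor b (e + e') (f * g) = taylor b e f * taylor b e' g
      + (\<Sum>l\<in>{..e + e'} - {e}. taylor b l f * taylor b (e + e' - l) g)"
    unfolding taylor_mult by (subst sum.remove[of _ e]) auto
  ultimately show ?thesis
    by (simp add: unique_euclidean_semiring_class.cong_def mod_add_right_eq[symmetric])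
qed

lemma vanishes_mult_right: "vanishes b K f \<Longrightarrow> vanishes b K (f * g)"
  using vanishes_mult[of b K f 0 g] by simp

lemma vanishes_mult_left: "vanishes b K f \<Longrightarrow> vanishes b K (g * f)"
  using vanishes_mult_right by (simp add: mult.commute)

lemma exact_order:
  assumes "\<not> vanishes b K f"
  obtains e where "e < K" "vanishes b e f" "\<not> p dvd taylor b e f"
proof -
  define e where "e = (LEAST i. \<not> p dvd taylor b i f)"
  obtain i where i: "i < K" "\<not> p dvd taylor b i f" using assms by (auto simp: vanishes_def)
  have "\<not> p dvd taylor b e f" unfolding e_def by (rule LeastI) (rule i)
  moreover have "e \<le> i" unfolding e_def by (rule Least_le) (rule i)
  moreover have "vanishes b e f" unfolding vanishes_def e_def using not_less_Least by blast
  ultimately show ?thesis using that[of e] i by simp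
qed

lemma vanishes_mult_cancel:
  assumes "\<not> p dvd poly u b" "vanishes b K (u * f)"
  shows "vanishes b K f"
proof (rule ccontr)
  assume "\<not> vanishes b K f"
  then obtain e where e: "e < K" "vanishes b e f" "\<not> p dvd taylor b e f" by (rule exact_order)
  have "[taylor b (0 + e) (u * f) = taylor b 0 u * taylor b e f] (mod p)"
    using e by (intro leading_taylor_mult) auto
  then have "\<not> p dvd taylor b e (u * f)"
    using e assms(1) prime_p by (simp add: taylor_0 cong_dvd_iff prime_dvd_mult_iff)
  then show False using assms(2) e by (auto simp: vanishes_def)
qed

lemma vanishes_pderiv: "vanishes b (Suc K) f \<Longrightarrow> vanishes b K (pderiv f)"
  by (auto simp: vanishes_def taylor_pderiv)

lemma vanishes_degree_null:
  assumes "vanishes b K f" "degree f < K"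
  shows "null f"
  unfolding null_iff_taylor[of f b]
proof
  fix i show "p dvd taylor b i f"
  proof (cases "i < K")
    case False
    then have "taylor b i f = 0"
      using assms by (simp add: taylor_def coeff_eq_0 degree_taylor_shift)
    then show ?thesis by simp
  qed (use assms in \<open>auto simp: vanishes_def\<close>)
qed

text \<open>
  The degree bound is what matters: the quotient of the Taylor polynomial is taken over the integers,
  where the degree does not depend on which coefficients \<open>p\<close> divides.
\<close>

lemma vanishes_factor:
  assumes "vanishes b K f" "K \<le> degree f"
  obtains g where "null (f - [:-b, 1:] ^ K * g)" "degree g \<le> degree f - K"
proof
  define G where "G = poly_shift K (pcompose f [:b, 1:])"
  define g where "g = pcompose G [:-b, 1:]"
  have G: "pcompose g [:b, 1:] = G"
    unfolding g_def by (simp flip: pcompose_assoc add: pcompose_pCons)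
  show "null (f - [:-b, 1:] ^ K * g)"
    unfolding null_iff_taylor[of _ b]
  proof
    fix i
    have lin: "pcompose [:-b, 1:] [:b, 1:] = [:0, 1:]" by (simp add: pcompose_pCons)
    have "taylor b i (f - [:-b, 1:] ^ K * g) = taylor b i f - coeff (monom 1 K * G) i"
      by (simp add: taylor_def pcompose_diff pcompose_mult pcompose_power G lin monom_altdef)
    also have "\<dots> = (if i < K then taylor b i f else 0)"
      by (simp add: coeff_monom_mult G_def coeff_poly_shift taylor_def)
    finally show "p dvd taylor b i (f - [:-b, 1:] ^ K * g)"
      using assms(1) by (auto simp: vanishes_def)
  qed
  have "degree G \<le> degree f - K"
    by (rule degree_le) (auto simp: G_def coeff_poly_shift degree_taylor_shift intro!: coeff_eq_0)
  then show "degree g \<le> degree f - K"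
    by (simp add: g_def degree_taylor_shift degree_pcompose)
qed

lemma null_mult_iff: "null (f * g) \<longleftrightarrow> null f \<or> null g"
  by (intro prime_elem_dvd_mult_iff)
     (metis prime_elem_const_poly_iff prime_imp_prime_elem prime_p)

text \<open>
  The bound for the number of zeros with multiplicity. Dividing off the zeros one at a time is
  possible because the residue classes form a field.
\<close>

lemma too_many_zeros_null:
  assumes "finite E"
    and "\<And>x y. x \<in> E \<Longrightarrow> y \<in> E \<Longrightarrow> x \<noteq> y \<Longrightarrow> \<not> p dvd x - y"
    and "\<And>x. x \<in> E \<Longrightarrow> vanishes x M f"
    and "degree f < M * card E"
  shows "null f"
  using assms
proof (induction E arbitrary: f rule: finite_induct)
  case (insert x E)
  show ?case
  proof (cases "degree f < M")
    case True
    then show ?thesis using vanishes_degree_null insert.prems by blast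
  next
    case False
    then obtain g where g: "null (f - [:-x, 1:] ^ M * g)" "degree g \<le> degree f - M"
      using vanishes_factor[of x M f] insert.prems by (metis insertI1 not_less)
    have "null g"
    proof (rule insert.IH)
      show "\<not> p dvd a - b" if "a \<in> E" "b \<in> E" "a \<noteq> b" for a b
        using insert.prems that by blast
      show "degree g < M * card E"
        using g insert.prems False insert.hyps by (simp add: card_insert_if)
      show "vanishes y M g" if "y \<in> E" for y
      proof (rule vanishes_mult_cancel)
        show "\<not> p dvd poly ([:-x, 1:] ^ M) y"
          using insert.prems(1)[of y x] that insert.hyps prime_p
          by (auto simp: poly_power prime_dvd_power_iff dest: prime_dvd_power)
        show "vanishes y M ([:-x, 1:] ^ M * g)"
          using vanishes_cong_null[OF g(1)] insert.prems(2)[of y] that by blast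
      qed
    qed
    then show ?thesis using dvd_add[OF g(1) dvd_mult[of _ g "[:-x, 1:] ^ M"]] by simp
  qed
qed auto

text \<open>
  Homogeneous linear systems with more unknowns than equations, by the box principle: there are more
  assignments of residues to the unknowns than values of the left-hand sides, and two assignments
  with the same values differ by a solution.
\<close>

lemma nontrivial_solution:
  fixes c :: "'k \<Rightarrow> 'i \<Rightarrow> int"
  assumes "finite I" "finite C" "card C < card I"
  obtains z where "\<exists>i\<in>I. \<not> p dvd z i" "\<And>k. k \<in> C \<Longrightarrow> p dvd (\<Sum>i\<in>I. z i * c k i)"
proof -
  define \<Phi> where "\<Phi> = (\<lambda>z. \<lambda>k\<in>C. (\<Sum>i\<in>I. z i * c k i) mod p)"
  let ?R = "{0..<p}"
  have "\<Phi> ` (I \<rightarrow>\<^sub>E ?R) \<subseteq> C \<rightarrow>\<^sub>E ?R"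
    using p_gt_1 by (auto simp: \<Phi>_def)
  then have "card (\<Phi> ` (I \<rightarrow>\<^sub>E ?R)) \<le> card (C \<rightarrow>\<^sub>E ?R)"
    by (intro card_mono finite_PiE) (use assms in auto)
  also have "\<dots> = nat p ^ card C" by (simp add: card_PiE assms)
  also have "\<dots> < nat p ^ card I"
    using p_gt_1 assms by (intro power_strict_increasing) auto
  also have "\<dots> = card (I \<rightarrow>\<^sub>E ?R)" by (simp add: card_PiE assms)
  finally have "\<not> inj_on \<Phi> (I \<rightarrow>\<^sub>E ?R)" by (rule pigeonhole)
  then obtain u v where uv: "u \<in> I \<rightarrow>\<^sub>E ?R" "v \<in> I \<rightarrow>\<^sub>E ?R" "u \<noteq> v" "\<Phi> u = \<Phi> v"
    by (auto simp: inj_on_def)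
  then obtain i where i: "i \<in> I" "u i \<noteq> v i" by (meson PiE_ext)
  show ?thesis
  proof
    have "\<bar>u i - v i\<bar> < p" "u i - v i \<noteq> 0"
      using PiE_mem[OF uv(1) i(1)] PiE_mem[OF uv(2) i(1)] i(2) by auto
    then have "\<not> p dvd u i - v i" using zdvd_imp_le[of p "\<bar>u i - v i\<bar>"] by auto
    then show "\<exists>i\<in>I. \<not> p dvd u i - v i" using i by blast
    fix k assume "k \<in> C"
    then have "(\<Sum>i\<in>I. u i * c k i) mod p = (\<Sum>i\<in>I. v i * c k i) mod p"
      using fun_cong[OF uv(4), of k] by (simp add: \<Phi>_def)
    then show "p dvd (\<Sum>i\<in>I. (u i - v i) * c k i)"
      by (simp add: left_diff_distrib sum_subtractf mod_eq_dvd_iff)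
  qed
qed

text \<open>
  Each \<open>k\<close> imposes at most \<open>E\<close> linear equations, one for each coefficient.
\<close>

lemma nontrivial_null_combinations:
  assumes "finite I" "finite C" "\<And>k i. k \<in> C \<Longrightarrow> i \<in> I \<Longrightarrow> degree (G k i) < E" "card C * E < card I"
  obtains z where "\<exists>i\<in>I. \<not> p dvd z i" "\<And>k. k \<in> C \<Longrightarrow> null (\<Sum>i\<in>I. smult (z i) (G k i))"
proof -
  obtain z where z: "\<exists>i\<in>I. \<not> p dvd z i"
    "\<And>k. k \<in> C \<times> {..<E} \<Longrightarrow> p dvd (\<Sum>i\<in>I. z i * coeff (G (fst k) i) (snd k))"
    by (rule nontrivial_solution[where I=I and C="C \<times> {..<E}"
          and c="\<lambda>k i. coeff (G (fst k) i) (snd k)"])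
       (use assms in auto)
  show ?thesis
  proof
    show "\<exists>i\<in>I. \<not> p dvd z i" by (rule z)
    fix k assume k: "k \<in> C"
    show "null (\<Sum>i\<in>I. smult (z i) (G k i))"
      unfolding const_poly_dvd_iff
    proof
      fix l
      show "p dvd coeff (\<Sum>i\<in>I. smult (z i) (G k i)) l"
      proof (cases "l < E")
        case True
        then show ?thesis using z(2)[of "(k, l)"] k by (simp add: coeff_sum)
      next
        case False
        then have "coeff (G k i) l = 0" if "i \<in> I" for i
          using assms(3)[OF k that] by (intro coeff_eq_0) auto
        then show ?thesis by (simp add: coeff_sum)
      qed
    qed
  qed
qed

end

section \<open>Differential equations modulo a prime\<close>

text \<open>
  When \<open>U' / U = r / P\<close>, the derivation \<open>P * d/dx\<close> maps \<open>h * U\<close> to \<open>twisted P r h * U\<close>. For \<open>r = 0\<close> it is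
  the derivation itself. The factor \<open>P\<close> keeps all coefficients polynomial.
\<close>

definition twisted :: "int poly \<Rightarrow> int poly \<Rightarrow> int poly \<Rightarrow> int poly" where
  "twisted P r h = P * pderiv h + r * h"

abbreviation euler :: "int poly \<Rightarrow> int poly \<Rightarrow> int poly" where
  "euler P \<equiv> twisted P 0"

lemma twisted_sum: "twisted P r (\<Sum>i\<in>I. f i) = (\<Sum>i\<in>I. twisted P r (f i))"
  by (induction I rule: infinite_finite_induct)
     (simp_all add: twisted_def pderiv_add algebra_simps)

lemma twisted_smult: "twisted P r (smult c f) = smult c (twisted P r f)"
  by (simp add: twisted_def pderiv_smult smult_add_right)

lemma twisted_funpow_sum: "(twisted P r ^^ s) (\<Sum>i\<in>I. f i) = (\<Sum>i\<in>I. (twisted P r ^^ s) (f i))"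
  by (induction s) (simp_all add: twisted_sum)

lemma twisted_funpow_smult: "(twisted P r ^^ s) (smult c f) = smult c ((twisted P r ^^ s) f)"
  by (induction s) (simp_all add: twisted_smult)

lemma degree_twisted_funpow:
  assumes "degree P \<le> k" "degree r \<le> k"
  shows "degree ((twisted P r ^^ s) h) \<le> degree h + k * s"
proof (induction s)
  case (Suc s)
  let ?f = "(twisted P r ^^ s) h"
  have "degree (P * pderiv ?f) \<le> k + degree ?f"
    using degree_mult_le[of P "pderiv ?f"] assms degree_pderiv[of ?f] by linarith
  moreover have "degree (r * ?f) \<le> k + degree ?f"
    using degree_mult_le[of r ?f] assms by linarith
  ultimately have "degree (twisted P r ?f) \<le> k + degree ?f"
    unfolding twisted_def by (rule degree_add_le)
  then show ?case using Suc by simp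
qed simp

context prime_modulus
begin

lemma null_twisted: "null f \<Longrightarrow> null (twisted P r f)"
proof -
  assume "null f"
  then obtain k where "f = [:p:] * k" by (elim dvdE)
  then have "twisted P r f = [:p:] * (P * pderiv k + r * k)"
    by (simp add: twisted_def pderiv_smult smult_add_right)
  then show ?thesis by (metis dvd_triv_left)
qed

lemma null_twisted_cong: "null (f - g) \<Longrightarrow> null (twisted P r f - twisted P r g)"
  using null_twisted[of "f - g" P r] by (simp add: twisted_def pderiv_diff algebra_simps)

lemma null_trans: "null (f - g) \<Longrightarrow> null (g - h) \<Longrightarrow> null (f - h)"
  using dvd_add[of "[:p:]" "f - g" "g - h"] by simp

text \<open>
  The logarithmic derivative of \<open>V\<close> has to be \<open>r / P\<close> modulo \<open>p\<close> only, so that \<open>V\<close> may contain a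
  \<open>p\<close>-th power, whose derivative vanishes modulo \<open>p\<close>.
\<close>

lemma euler_funpow_mult:
  assumes "null (P * pderiv V - r * V)"
  shows "null ((euler P ^^ s) (h * V) - (twisted P r ^^ s) h * V)"
proof (induction s)
  case (Suc s)
  let ?h = "(twisted P r ^^ s) h"
  have "euler P (?h * V) - twisted P r ?h * V = ?h * (P * pderiv V - r * V)"
    by (simp add: twisted_def pderiv_mult algebra_simps)
  then have "null (euler P (?h * V) - twisted P r ?h * V)" using assms by simp
  from null_trans[OF null_twisted_cong[OF Suc] this] show ?case by simp
qed simp

lemma vanishes_euler: "vanishes b (Suc K) f \<Longrightarrow> vanishes b K (euler P f)"
  by (simp add: twisted_def vanishes_mult_left vanishes_pderiv)

lemma vanishes_euler_funpow: "vanishes b K f \<Longrightarrow> s \<le> K \<Longrightarrow> vanishes b (K - s) ((euler P ^^ s) f)"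
proof (induction s)
  case (Suc s)
  then have "vanishes b (Suc (K - Suc s)) ((euler P ^^ s) f)" by (simp add: Suc_diff_Suc)
  then show ?case by (simp add: vanishes_euler)
qed simp

text \<open>
  Where \<open>P\<close> is invertible, the derivation lowers an order of vanishing \<open>e\<close> by exactly one, since the
  leading coefficient gets multiplied by \<open>e\<close>, which \<open>p\<close> does not divide if \<open>0 < e < p\<close>.
\<close>

lemma euler_funpow_nonzero:
  assumes "\<not> p dvd poly P b" "vanishes b e f" "\<not> p dvd taylor b e f" "int e < p"
  shows "\<not> p dvd poly ((euler P ^^ e) f) b"
  using assms(2-)
proof (induction e arbitrary: f)
  case 0
  then show ?case by (simp add: taylor_0)
next
  case (Suc e)
  have "\<not> p dvd int (Suc e)" using Suc.prems(3) zdvd_imp_le by force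
  then have "\<not> p dvd taylor b e (pderiv f)"
    using Suc.prems(2) prime_p by (simp only: taylor_pderiv prime_dvd_mult_iff) simp
  moreover have "[taylor b (0 + e) (P * pderiv f) = taylor b 0 P * taylor b e (pderiv f)] (mod p)"
    using Suc.prems by (intro leading_taylor_mult vanishes_pderiv) auto
  ultimately have "\<not> p dvd taylor b e (euler P f)"
    using assms(1) prime_p by (simp add: taylor_0 twisted_def cong_dvd_iff prime_dvd_mult_iff)
  then have "\<not> p dvd poly ((euler P ^^ e) (euler P f)) b"
    using Suc.prems by (intro Suc.IH vanishes_euler) auto
  then show ?case by (simp add: funpow_swap1)
qed

text \<open>
  This turns vanishing to order \<open>M\<close> into \<open>M\<close> equations between values, in which the value of a large
  power may be replaced by the residue that it is known to have.
\<close>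

lemma vanishes_by_values:
  assumes "\<not> p dvd poly P x" "int M \<le> p" "\<And>s. s < M \<Longrightarrow> p dvd poly ((euler P ^^ s) f) x"
  shows "vanishes x M f"
proof (rule ccontr)
  assume "\<not> vanishes x M f"
  then obtain e where "e < M" "vanishes x e f" "\<not> p dvd taylor x e f" by (rule exact_order)
  then show False using euler_funpow_nonzero[OF assms(1)] assms(2) assms(3)[of e] by simp
qed

text \<open>
  At a simple zero of \<open>P\<close> the derivation is, to leading order, a multiple of \<open>x * d/dx\<close>: a function with
  leading term \<open>x^e\<close> behaves like an eigenfunction with eigenvalue proportional to \<open>e\<close>.
\<close>

lemma euler_funpow_simple_zero:
  assumes "P = [:-a, 1:] * P1" "vanishes a e f"
  shows "vanishes a e ((euler P ^^ s) f)"
    and "[taylor a e ((euler P ^^ s) f) = (poly P1 a * int e) ^ s * taylor a e f] (mod p)"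
proof -
  have step: "vanishes a e (euler P f) \<and> [taylor a e (euler P f) = poly P1 a * int e * taylor a e f] (mod p)"
    if f: "vanishes a e f" for f
  proof (cases e)
    case 0
    then show ?thesis by (simp add: taylor_0 twisted_def assms(1))
  next
    case (Suc d)
    have d: "vanishes a d (pderiv f)" using f Suc vanishes_pderiv by simp
    have lin: "taylor a i [:-a, 1:] = (if i = 1 then 1 else 0)" for i
      using taylor_linear_power[of a i 1] by simp
    have P: "vanishes a 1 P" "[taylor a 1 P = poly P1 a] (mod p)"
      using leading_taylor_mult[of a 1 "[:-a, 1:]" 0 P1] vanishes_mult_right[of a 1 "[:-a, 1:]" P1]
      unfolding assms(1) by (simp_all add: vanishes_def lin taylor_0)
    have "vanishes a (1 + d) (P * pderiv f)"
      by (rule vanishes_mult) (fact P d)+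
    moreover have "[taylor a (1 + d) (P * pderiv f) = taylor a 1 P * taylor a d (pderiv f)] (mod p)"
      by (rule leading_taylor_mult) (fact P d)+
    moreover have "[taylor a 1 P * taylor a d (pderiv f) = poly P1 a * taylor a d (pderiv f)] (mod p)"
      using P by (intro cong_mult) auto
    ultimately show ?thesis
      by (auto simp: Suc twisted_def taylor_pderiv mult_ac intro: cong_trans)
  qed
  have "vanishes a e ((euler P ^^ s) f) \<and>
     [taylor a e ((euler P ^^ s) f) = (poly P1 a * int e) ^ s * taylor a e f] (mod p)"
  proof (induction s)
    case (Suc s)
    have "[poly P1 a * int e * taylor a e ((euler P ^^ s) f)
        = poly P1 a * int e * ((poly P1 a * int e) ^ s * taylor a e f)] (mod p)"
      using Suc by (intro cong_mult) auto
    then show ?case using step[of "(euler P ^^ s) f"] Suc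
      by (auto simp: mult_ac intro: cong_trans)
  qed (use assms in auto)
  then show "vanishes a e ((euler P ^^ s) f)"
    and "[taylor a e ((euler P ^^ s) f) = (poly P1 a * int e) ^ s * taylor a e f] (mod p)" by auto
qed

text \<open>
  Apply an operator \<open>\<Sum>s<n. q s * (P * d/dx)^s\<close> with unknown coefficients of degree below \<open>T\<close> to the sum. It
  maps \<open>h j * U j\<close> to a low-degree multiple of \<open>U j\<close>, and for large \<open>T\<close> there are enough unknowns to make
  this multiple zero for all \<open>j\<close> except one. The image of the sum is then a single product \<open>N * U j1\<close>
  that still vanishes to high order at \<open>b\<close>, where \<open>U j1\<close> is invertible; so \<open>N\<close>, whose degree is low, is
  zero as well.
\<close>

lemma annihilating_operator:
  fixes S :: "'j set"
  assumes "finite S" "S \<noteq> {}" "n = card S"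
    and deg: "degree P \<le> k" "\<And>j. j \<in> S \<Longrightarrow> degree (r j) \<le> k" "\<And>j. j \<in> S \<Longrightarrow> degree (h j) \<le> A"
    and U: "\<And>j. j \<in> S \<Longrightarrow> P * pderiv (U j) = r j * U j" "\<And>j. j \<in> S \<Longrightarrow> \<not> p dvd poly (U j) b"
    and van: "vanishes b K (\<Sum>j\<in>S. h j * U j)"
    and K: "n * (A + k * n + 1) + A + k * n + n \<le> K"
  obtains q where "\<exists>s<n. \<not> null (q s)"
    and "\<And>j. j \<in> S \<Longrightarrow> null (\<Sum>s<n. q s * (euler P ^^ s) (h j * U j))"
proof -
  \<comment> \<open>the \<open>n * T\<close> unknowns outnumber the \<open>(n - 1) * E\<close> equations as soon as \<open>T > (n - 1) * (A + k * n)\<close>\<close>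
  define T where "T = n * (A + k * n + 1)"
  define E where "E = T + A + k * n"
  define G where "G = (\<lambda>j i. monom 1 (snd i) * (twisted P (r j) ^^ fst i) (h j))"
  obtain j1 where j1: "j1 \<in> S" using assms(2) by auto
  have n: "n \<ge> 1" using assms(1-3) by (simp add: Suc_le_eq card_gt_0_iff)
  have degG: "degree (G j i) < E" if "j \<in> S" "i \<in> {..<n} \<times> {..<T}" for j i
  proof -
    have "degree (G j i) \<le> snd i + degree ((twisted P (r j) ^^ fst i) (h j))"
      using degree_mult_le[of "monom (1::int) (snd i)"] by (auto simp: G_def degree_monom_eq)
    also have "degree ((twisted P (r j) ^^ fst i) (h j)) \<le> degree (h j) + k * fst i"
      using deg that by (intro degree_twisted_funpow) auto
    also have "\<dots> \<le> A + k * n" using deg that by (intro add_mono mult_le_mono) auto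
    finally show ?thesis using that by (auto simp: E_def)
  qed
  have "card (S - {j1}) * E < card ({..<n} \<times> {..<T})"
  proof -
    obtain m where m: "n = Suc m" using n by (cases n) auto
    then have "card (S - {j1}) = m" using j1 assms(1,3) by simp
    moreover have "m * E < n * T"
    proof -
      have "m * (A + k * n) < T" unfolding T_def m by (simp add: algebra_simps)
      then show ?thesis by (simp add: E_def m algebra_simps)
    qed
    ultimately show ?thesis by simp
  qed
  then obtain z where z: "\<exists>i\<in>{..<n} \<times> {..<T}. \<not> p dvd z i"
    "\<And>j. j \<in> S - {j1} \<Longrightarrow> null (\<Sum>i\<in>{..<n} \<times> {..<T}. smult (z i) (G j i))"
    by (rule nontrivial_null_combinations[where G = G, rotated 3])
       (use degG assms(1) in \<open>blast+\<close>)
  define q where "q = (\<lambda>s. \<Sum>t<T. monom (z (s, t)) t)"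
  have coeff_q: "coeff (q s) t = z (s, t)" if "t < T" for s t
    using that by (simp add: q_def coeff_sum)
  have G_eq: "(\<Sum>i\<in>{..<n} \<times> {..<T}. smult (z i) (G j i)) = (\<Sum>s<n. q s * (twisted P (r j) ^^ s) (h j))" for j
  proof -
    have "(\<Sum>s<n. q s * (twisted P (r j) ^^ s) (h j)) = (\<Sum>s<n. \<Sum>t<T. smult (z (s, t)) (G j (s, t)))"
      unfolding q_def G_def sum_distrib_right
      by (intro sum.cong refl) (simp add: smult_monom flip: mult_smult_left)
    then show ?thesis by (simp add: sum.cartesian_product)
  qed
  have conv: "null ((\<Sum>s<n. q s * (euler P ^^ s) (h j * U j))
      - (\<Sum>s<n. q s * (twisted P (r j) ^^ s) (h j)) * U j)" if "j \<in> S" for j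
  proof -
    have "null (\<Sum>s<n. q s * ((euler P ^^ s) (h j * U j) - (twisted P (r j) ^^ s) (h j) * U j))"
      using U(1)[OF that] by (intro dvd_sum dvd_mult euler_funpow_mult) simp
    then show ?thesis by (simp add: algebra_simps sum_subtractf sum_distrib_left sum_distrib_right)
  qed
  have kill: "null (\<Sum>s<n. q s * (euler P ^^ s) (h j * U j))" if "j \<in> S - {j1}" for j
    using dvd_add[OF conv[of j] dvd_mult2[OF z(2)[OF that], of "U j"]] that by (simp add: G_eq)
  define N where "N = (\<Sum>s<n. q s * (twisted P (r j1) ^^ s) (h j1))"
  have rest: "null (\<Sum>j\<in>S-{j1}. \<Sum>s<n. q s * (euler P ^^ s) (h j * U j))"
    using kill by (rule dvd_sum)
  have "vanishes b (K - n) (\<Sum>s<n. q s * (euler P ^^ s) (\<Sum>j\<in>S. h j * U j))"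
  proof (intro vanishes_sum vanishes_mult_left)
    fix s assume "s \<in> {..<n}"
    then show "vanishes b (K - n) ((euler P ^^ s) (\<Sum>j\<in>S. h j * U j))"
      using vanishes_euler_funpow[OF van, of s P] K by (auto elim!: vanishes_mono)
  qed
  also have "(\<Sum>s<n. q s * (euler P ^^ s) (\<Sum>j\<in>S. h j * U j))
      = (\<Sum>j\<in>S. \<Sum>s<n. q s * (euler P ^^ s) (h j * U j))"
    by (simp add: twisted_funpow_sum sum_distrib_left) (rule sum.swap)
  also have "\<dots> = (\<Sum>s<n. q s * (euler P ^^ s) (h j1 * U j1))
      + (\<Sum>j\<in>S-{j1}. \<Sum>s<n. q s * (euler P ^^ s) (h j * U j))"
    using assms(1) j1 by (rule sum.remove)
  finally have "vanishes b (K - n) (\<Sum>s<n. q s * (euler P ^^ s) (h j1 * U j1))"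
    using vanishes_cong_null[of "(\<Sum>s<n. q s * (euler P ^^ s) (h j1 * U j1))
      + (\<Sum>j\<in>S-{j1}. \<Sum>s<n. q s * (euler P ^^ s) (h j * U j))"
      "(\<Sum>s<n. q s * (euler P ^^ s) (h j1 * U j1))"] rest
    by simp
  then have "vanishes b (K - n) (U j1 * N)"
    using vanishes_cong_null[OF conv[OF j1]] by (simp add: N_def mult.commute)
  then have "vanishes b (K - n) N" using U(2)[OF j1] vanishes_mult_cancel by blast
  moreover have "degree N < K - n"
  proof -
    have "degree N \<le> E - 1"
      unfolding N_def G_eq[symmetric]
      by (intro degree_sum_le) (use degG j1 in \<open>force intro: order.trans[OF degree_smult_le]\<close>)+
    moreover have "E \<ge> 1" using n by (simp add: E_def T_def)
    ultimately show ?thesis using K by (simp add: E_def T_def)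
  qed
  ultimately have "null N" by (rule vanishes_degree_null)
  then have "null (\<Sum>s<n. q s * (euler P ^^ s) (h j1 * U j1))"
    using dvd_add[OF conv[OF j1] dvd_mult2[of _ N "U j1"]] by (simp add: N_def)
  then have "\<And>j. j \<in> S \<Longrightarrow> null (\<Sum>s<n. q s * (euler P ^^ s) (h j * U j))"
    using kill by blast
  moreover have "\<exists>s<n. \<not> null (q s)"
  proof -
    obtain s t where "s < n" "t < T" "\<not> p dvd z (s, t)" using z(1) by auto
    then have "\<not> null (q s)" using coeff_q[of t s] unfolding const_poly_dvd_iff by metis
    with \<open>s < n\<close> show ?thesis by blast
  qed
  ultimately show ?thesis using that by blast
qed

text \<open>
  The indicial polynomial of the equation: if \<open>\<mu>\<close> is the least order of the coefficients \<open>q s\<close> at \<open>a\<close>,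
  then comparing the terms of order \<open>\<mu> + e\<close> in the equation for a solution of order \<open>e\<close> makes
  \<open>P'(a) * e\<close> a root of \<open>I\<close>, whose coefficients are the Taylor coefficients of order \<open>\<mu>\<close> of the \<open>q s\<close>.
\<close>

lemma few_exponents:
  assumes P: "P = [:-a, 1:] * P1" "\<not> p dvd poly P1 a"
    and q: "\<exists>s<n. \<not> null (q s)"
    and E: "finite E" "\<And>e. e \<in> E \<Longrightarrow> int e < p"
    and sol: "\<And>e. e \<in> E \<Longrightarrow> \<exists>f. vanishes a e f \<and> \<not> p dvd taylor a e f \<and>
       null (\<Sum>s<n. q s * (euler P ^^ s) f)"
  shows "card E < n"
proof (rule ccontr)
  assume "\<not> card E < n"
  define \<mu> where "\<mu> = (LEAST i. \<exists>s<n. \<not> p dvd taylor a i (q s))"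
  obtain s i where "s < n" "\<not> p dvd taylor a i (q s)"
    using q by (auto simp: null_iff_taylor[of _ a])
  then have "\<exists>i. \<exists>s<n. \<not> p dvd taylor a i (q s)" by auto
  from LeastI_ex[OF this] obtain s0 where s0: "s0 < n" "\<not> p dvd taylor a \<mu> (q s0)"
    unfolding \<mu>_def by auto
  have q\<mu>: "vanishes a \<mu> (q s)" if "s < n" for s
    unfolding vanishes_def \<mu>_def using that by (auto dest: not_less_Least)
  define I where "I = (\<Sum>s<n. monom (taylor a \<mu> (q s)) s)"
  have coeff_I: "coeff I s = taylor a \<mu> (q s)" if "s < n" for s
    using that by (simp add: I_def coeff_sum)
  have root: "p dvd poly I (poly P1 a * int e)" if e: "e \<in> E" for e
  proof -
    obtain f where f: "vanishes a e f" "\<not> p dvd taylor a e f" "null (\<Sum>s<n. q s * (euler P ^^ s) f)"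
      using sol[OF e] by blast
    have "[taylor a (\<mu> + e) (\<Sum>s<n. q s * (euler P ^^ s) f)
        = (\<Sum>s<n. taylor a \<mu> (q s) * ((poly P1 a * int e) ^ s * taylor a e f))] (mod p)"
      unfolding taylor_sum
    proof (rule cong_sum)
      fix s assume s: "s \<in> {..<n}"
      have "[taylor a (\<mu> + e) (q s * (euler P ^^ s) f)
          = taylor a \<mu> (q s) * taylor a e ((euler P ^^ s) f)] (mod p)"
        using s q\<mu> euler_funpow_simple_zero(1)[OF P(1) f(1)] by (intro leading_taylor_mult) auto
      also have "[taylor a \<mu> (q s) * taylor a e ((euler P ^^ s) f)
          = taylor a \<mu> (q s) * ((poly P1 a * int e) ^ s * taylor a e f)] (mod p)"
        using euler_funpow_simple_zero(2)[OF P(1) f(1)] by (intro cong_mult) auto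
      finally show "[taylor a (\<mu> + e) (q s * (euler P ^^ s) f)
          = taylor a \<mu> (q s) * ((poly P1 a * int e) ^ s * taylor a e f)] (mod p)" .
    qed
    also have eq: "(\<Sum>s<n. taylor a \<mu> (q s) * ((poly P1 a * int e) ^ s * taylor a e f))
        = poly I (poly P1 a * int e) * taylor a e f"
      by (simp add: I_def poly_sum poly_monom sum_distrib_left sum_distrib_right mult_ac)
    finally have "p dvd poly I (poly P1 a * int e) * taylor a e f"
      using cong_dvd_iff null_taylor[OF f(3), of a "\<mu> + e"] by blast
    then show ?thesis using f(2) prime_p by (simp add: prime_dvd_mult_iff)
  qed
  have inj: "\<not> p dvd poly P1 a * int e - poly P1 a * int e'"
    if "e \<in> E" "e' \<in> E" "e \<noteq> e'" for e e'
  proof -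
    have "\<not> p dvd int e - int e'"
      using that E(2)[of e] E(2)[of e'] zdvd_imp_le[of p "\<bar>int e - int e'\<bar>"] by auto
    then show ?thesis using P(2) prime_p by (simp add: prime_dvd_mult_iff flip: right_diff_distrib)
  qed
  have card: "card ((\<lambda>e. poly P1 a * int e) ` E) = card E"
  proof (intro card_image inj_onI)
    fix e e' assume "e \<in> E" "e' \<in> E" "poly P1 a * int e = poly P1 a * int e'"
    then show "e = e'" using inj[of e e'] by (cases "e = e'") auto
  qed
  have "degree I \<le> n - 1"
    unfolding I_def by (intro degree_sum_le) (auto intro: order.trans[OF degree_monom_le])
  then have "degree I < 1 * card ((\<lambda>e. poly P1 a * int e) ` E)"
    using \<open>\<not> card E < n\<close> s0(1) card by simp
  then have "null I"
  proof (rule too_many_zeros_null[rotated 3])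
    show "finite ((\<lambda>e. poly P1 a * int e) ` E)" using E(1) by simp
    show "\<not> p dvd x - y" if "x \<in> (\<lambda>e. poly P1 a * int e) ` E" "y \<in> (\<lambda>e. poly P1 a * int e) ` E" "x \<noteq> y" for x y
      using that inj by auto
    show "vanishes x 1 I" if "x \<in> (\<lambda>e. poly P1 a * int e) ` E" for x
      using that root by (auto simp: vanishes_def taylor_0)
  qed
  then have "p dvd coeff I s0" unfolding const_poly_dvd_iff by blast
  then show False using s0 coeff_I[of s0] by simp
qed

text \<open>
  If there were fewer orders than functions, some nontrivial combination would have zero Taylor
  coefficient at each of the orders that occur, including its own order.
\<close>

lemma many_orders:
  assumes "finite S"
    and "\<And>z. \<exists>j\<in>S. \<not> p dvd z j \<Longrightarrow> \<not> vanishes a K (\<Sum>j\<in>S. smult (z j) (W j))"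
  shows "card S \<le> card {e. e < K \<and> (\<exists>z. vanishes a e (\<Sum>j\<in>S. smult (z j) (W j)) \<and>
           \<not> p dvd taylor a e (\<Sum>j\<in>S. smult (z j) (W j)))}" (is "_ \<le> card ?E")
proof (rule ccontr)
  assume "\<not> card S \<le> card ?E"
  moreover have "finite ?E" by simp
  ultimately obtain z where z: "\<exists>j\<in>S. \<not> p dvd z j"
     "\<And>e. e \<in> ?E \<Longrightarrow> p dvd (\<Sum>j\<in>S. z j * taylor a e (W j))"
    using nontrivial_solution[of S ?E "\<lambda>e j. taylor a e (W j)"] assms(1) by (auto simp: not_le)
  let ?w = "\<Sum>j\<in>S. smult (z j) (W j)"
  obtain e where e: "e < K" "vanishes a e ?w" "\<not> p dvd taylor a e ?w"
    using exact_order[OF assms(2)[OF z(1)]] by blast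
  then have "e \<in> ?E" by blast
  then show False using z(2)[of e] e(3) by (simp add: taylor_sum taylor_smult)
qed

end

section \<open>Independence of products of radicals\<close>

definition root_product :: "(nat \<Rightarrow> int) \<Rightarrow> nat \<Rightarrow> int poly" where
  "root_product a k = (\<Prod>i<k. [:- a i, 1:])"

text \<open>
  If \<open>g * D = p - 1\<close>, then modulo \<open>p\<close> the \<open>D\<close>-th power of \<open>(x - a)^g\<close> is \<open>(x^p - a) / (x - a)\<close>. As \<open>x^p\<close> is
  a constant for the derivation, \<open>(x - a)^g\<close> plays the role of a \<open>D\<close>-th root of \<open>1 / (x - a)\<close>.
\<close>

definition radical_product :: "(nat \<Rightarrow> int) \<Rightarrow> nat \<Rightarrow> nat \<Rightarrow> (nat \<Rightarrow> nat) \<Rightarrow> int poly" where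
  "radical_product a g k j = (\<Prod>i<k. [:- a i, 1:] ^ (g * j i))"

fun log_deriv :: "(nat \<Rightarrow> int) \<Rightarrow> nat \<Rightarrow> nat \<Rightarrow> (nat \<Rightarrow> nat) \<Rightarrow> int poly" where
  "log_deriv a g 0 j = 0"
| "log_deriv a g (Suc k) j =
     [:- a k, 1:] * log_deriv a g k j + smult (int (g * j k)) (root_product a k)"

lemma root_product_Suc: "root_product a (Suc k) = [:- a k, 1:] * root_product a k"
  by (simp add: root_product_def)

lemma radical_product_Suc:
  "radical_product a g (Suc k) j = [:- a k, 1:] ^ (g * j k) * radical_product a g k j"
  by (simp add: radical_product_def)

lemma degree_root_product: "degree (root_product a k) \<le> k"
proof (induction k)
  case (Suc k)
  then show ?case using degree_mult_le[of "[:- a k, 1:]" "root_product a k"]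
    by (simp add: root_product_Suc)
qed (simp add: root_product_def)

lemma degree_log_deriv: "degree (log_deriv a g k j) \<le> k"
proof (induction k)
  case (Suc k)
  have "degree ([:- a k, 1:] * log_deriv a g k j) \<le> Suc k"
    using degree_mult_le[of "[:- a k, 1:]" "log_deriv a g k j"] Suc by simp
  moreover have "degree (smult (int (g * j k)) (root_product a k)) \<le> Suc k"
    using degree_root_product[of a k] degree_smult_le[of "int (g * j k)" "root_product a k"] by linarith
  ultimately show ?case unfolding log_deriv.simps by (rule degree_add_le)
qed simp

lemma pderiv_radical_product:
  "root_product a k * pderiv (radical_product a g k j) = log_deriv a g k j * radical_product a g k j"
proof (induction k)
  case (Suc k)
  let ?x = "[:- a k, 1:]" and ?e = "g * j k"
  let ?P = "root_product a k" and ?U = "radical_product a g k j" and ?L = "log_deriv a g k j"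
  have x: "?x * pderiv (?x ^ ?e) = smult (int ?e) (?x ^ ?e)"
  proof (cases ?e)
    case (Suc e)
    have "?x * pderiv (?x ^ Suc e) = smult (int (Suc e)) (?x * ?x ^ e)"
      unfolding pderiv_power_Suc by (simp add: pderiv_pCons del: mult_pCons_left mult_pCons_right flip: one_pCons)
    then show ?thesis unfolding Suc power_Suc .
  next
    case 0
    show ?thesis unfolding 0 by simp
  qed
  have "root_product a (Suc k) * pderiv (radical_product a g (Suc k) j)
      = ?x * ?x ^ ?e * (?P * pderiv ?U) + ?P * ?U * (?x * pderiv (?x ^ ?e))"
    unfolding root_product_Suc radical_product_Suc pderiv_mult by (simp only: algebra_simps)
  also have "\<dots> = log_deriv a g (Suc k) j * radical_product a g (Suc k) j"
    unfolding Suc x radical_product_Suc log_deriv.simps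
    by (simp only: algebra_simps mult_smult_left mult_smult_right)
  finally show ?case .
qed (simp add: radical_product_def)

lemma smult_sum_right: "smult c (\<Sum>i\<in>I. f i) = (\<Sum>i\<in>I. smult c (f i))"
  by (induction I rule: infinite_finite_induct) (simp_all add: smult_add_right)

context prime_modulus
begin

lemma poly_root_product_nonzero:
  "(\<And>i. i < k \<Longrightarrow> \<not> p dvd b - a i) \<Longrightarrow> \<not> p dvd poly (root_product a k) b"
  using prime_p by (simp add: root_product_def poly_prod prime_dvd_prod_iff)

lemma poly_radical_product_nonzero:
  assumes "\<And>i. i < k \<Longrightarrow> \<not> p dvd b - a i"
  shows "\<not> p dvd poly (radical_product a g k j) b"
proof
  assume "p dvd poly (radical_product a g k j) b"
  then obtain i where "i < k" "p dvd (b - a i) ^ (g * j i)"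
    using prime_p by (auto simp: radical_product_def poly_prod prime_dvd_prod_iff poly_power)
  then show False using assms prime_dvd_power[OF prime_p] by blast
qed

text \<open>
  The induction on \<open>k\<close> needs all points \<open>b\<close> at once, because it uses the hypothesis for the first
  \<open>k\<close> radicals at the position \<open>a k\<close> of the next one. There the sets \<open>Eo j0\<close> collect the orders of
  combinations of the products with \<open>j k = j0\<close>, freed of the common factor \<open>(x - a k)^(g * j0)\<close>. They lie
  below \<open>K \<le> g\<close>, so the exponents \<open>g * j0 + e\<close> are pairwise distinct and below \<open>g * D = p - 1\<close>.
\<close>

lemma radical_products_independent:
  fixes S :: "(nat \<Rightarrow> nat) set"
  assumes gD: "int (g * D) = p - 1" "K \<le> g"
    and distinct: "\<And>i l. i < \<kappa> \<Longrightarrow> l < \<kappa> \<Longrightarrow> i \<noteq> l \<Longrightarrow> \<not> p dvd a i - a l"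
    and K: "N * (A + \<kappa> * N + 1) + A + \<kappa> * N + N \<le> K"
    and "k \<le> \<kappa>" "finite S" "S \<noteq> {}" "card S \<le> N"
    and "\<And>j i. j \<in> S \<Longrightarrow> i < k \<Longrightarrow> j i < D"
    and "\<And>j j'. j \<in> S \<Longrightarrow> j' \<in> S \<Longrightarrow> (\<And>i. i < k \<Longrightarrow> j i = j' i) \<Longrightarrow> j = j'"
    and "\<And>j. j \<in> S \<Longrightarrow> \<not> null (h j)" "\<And>j. j \<in> S \<Longrightarrow> degree (h j) \<le> A"
    and "\<And>i. i < k \<Longrightarrow> \<not> p dvd b - a i"
  shows "\<not> vanishes b K (\<Sum>j\<in>S. h j * radical_product a g k j)"
  using assms(5-)
proof (induction k arbitrary: S h b)
  case 0
  then have N: "N \<ge> 1" by (metis card_gt_0_iff less_le_trans Suc_le_eq One_nat_def)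
  obtain j where "j \<in> S" using 0 by blast
  then have S: "S = {j}" using 0(6) by blast
  have "degree (h j) < K" using 0(8)[of j] S K N by simp
  then show ?case using S 0(7)[of j] vanishes_degree_null[of b K "h j"] by (auto simp: radical_product_def)
next
  case (Suc k)
  define n where "n = card S"
  let ?P = "root_product a (Suc k)" and ?U = "radical_product a g (Suc k)"
  show ?case
  proof
    assume van: "vanishes b K (\<Sum>j\<in>S. h j * ?U j)"
    have "n * (A + \<kappa> * n + 1) \<le> N * (A + \<kappa> * N + 1)" "\<kappa> * n \<le> \<kappa> * N" "n \<le> N"
      using Suc.prems(4) unfolding n_def by (intro mult_le_mono add_mono order.refl | assumption)+
    then have nK: "n * (A + \<kappa> * n + 1) + A + \<kappa> * n + n \<le> K"
      using K by linarith
    obtain q where q: "\<exists>s<n. \<not> null (q s)"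
      "\<And>j. j \<in> S \<Longrightarrow> null (\<Sum>s<n. q s * (euler ?P ^^ s) (h j * ?U j))"
    proof (rule annihilating_operator[OF Suc.prems(2,3) n_def, where P = ?P and h = h and U = ?U
          and r = "log_deriv a g (Suc k)" and k = \<kappa> and A = A and b = b and K = K])
      show "degree ?P \<le> \<kappa>" using degree_root_product Suc.prems(1) le_trans by blast
      show "degree (log_deriv a g (Suc k) j) \<le> \<kappa>" for j
        using degree_log_deriv Suc.prems(1) le_trans by blast
    qed (use Suc.prems pderiv_radical_product poly_radical_product_nonzero van nK in auto)
    define T where "T = (\<lambda>j0. {j \<in> S. j k = j0})"
    define w where "w = (\<lambda>j0 z. \<Sum>j\<in>T j0. smult (z j) (h j * radical_product a g k j))"
    define Eo where "Eo = (\<lambda>j0. {e. e < K \<and> (\<exists>z. vanishes (a k) e (w j0 z) \<and> \<not> p dvd taylor (a k) e (w j0 z))})"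
    have finT: "finite (T j0)" for j0 using Suc.prems(2) by (simp add: T_def)
    have Eo: "card (T j0) \<le> card (Eo j0)" for j0
      unfolding Eo_def w_def
    proof (rule many_orders[OF finT])
      fix z assume z: "\<exists>j\<in>T j0. \<not> p dvd z j"
      define S' where "S' = {j \<in> T j0. \<not> p dvd z j}"
      have S': "S' \<subseteq> S" "finite S'" "S' \<subseteq> T j0"
        using Suc.prems(2) by (auto simp: S'_def T_def)
      have "\<not> vanishes (a k) K (\<Sum>j\<in>S'. smult (z j) (h j) * radical_product a g k j)"
      proof (rule Suc.IH)
        show "k \<le> \<kappa>" "finite S'" "S' \<noteq> {}" using Suc.prems S' z by (auto simp: S'_def)
        show "card S' \<le> N" using card_mono[OF Suc.prems(2) S'(1)] Suc.prems(4) by linarith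
        show "j i < D" if "j \<in> S'" "i < k" for j i using Suc.prems(5) that S' by auto
        show "j = j'" if "j \<in> S'" "j' \<in> S'" "\<And>i. i < k \<Longrightarrow> j i = j' i" for j j'
        proof (rule Suc.prems(6))
          show "j i = j' i" if "i < Suc k" for i
            using that \<open>j \<in> S'\<close> \<open>j' \<in> S'\<close> \<open>\<And>i. i < k \<Longrightarrow> j i = j' i\<close>
            by (cases "i = k") (auto simp: S'_def T_def)
        qed (use that S' in auto)
        show "\<not> null (smult (z j) (h j))" if "j \<in> S'" for j
          using that Suc.prems(7)[of j] S' prime_p null_mult_iff[of "[:z j:]" "h j"]
          by (auto simp: S'_def)
        show "degree (smult (z j) (h j)) \<le> A" if "j \<in> S'" for j
          using that Suc.prems(8)[of j] S' degree_smult_le[of "z j" "h j"] by (meson le_trans subsetD)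
        show "\<not> p dvd a k - a i" if "i < k" for i
          using distinct that Suc.prems(1) by simp
      qed
      moreover have "null ((\<Sum>j\<in>T j0. smult (z j) (h j * radical_product a g k j))
         - (\<Sum>j\<in>S'. smult (z j) (h j) * radical_product a g k j))"
      proof -
        have "(\<Sum>j\<in>T j0. smult (z j) (h j * radical_product a g k j))
            = (\<Sum>j\<in>T j0 - S'. smult (z j) (h j * radical_product a g k j))
              + (\<Sum>j\<in>S'. smult (z j) (h j * radical_product a g k j))"
          using finT S'(3) by (rule sum.subset_diff[rotated])
        moreover have "null (\<Sum>j\<in>T j0 - S'. smult (z j) (h j * radical_product a g k j))"
          by (intro dvd_sum) (auto simp: S'_def const_poly_dvd_iff)
        ultimately show ?thesis by simp
      qed
      ultimately show "\<not> vanishes (a k) K (\<Sum>j\<in>T j0. smult (z j) (h j * radical_product a g k j))"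
        using vanishes_cong_null by blast
    qed
    define E where "E = (\<Union>j0<D. (\<lambda>e. g * j0 + e) ` Eo j0)"
    have finEo: "finite (Eo j0)" for j0 by (simp add: Eo_def)
    have Eo_less: "e < g" if "e \<in> Eo j0" for e j0 using that gD(2) by (simp add: Eo_def)
    have "card E < n"
    proof (rule few_exponents[of ?P "a k" "root_product a k" n q E])
      show "?P = [:- a k, 1:] * root_product a k" by (rule root_product_Suc)
      show "\<not> p dvd poly (root_product a k) (a k)"
        using Suc.prems(1) distinct by (intro poly_root_product_nonzero) simp
      show "\<exists>s<n. \<not> null (q s)" by (rule q)
      show "finite E" by (simp add: E_def finEo)
      fix e assume "e \<in> E"
      then obtain j0 e0 where e: "j0 < D" "e0 \<in> Eo j0" "e = g * j0 + e0" by (auto simp: E_def)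
      have "g * j0 + g \<le> g * D" using e(1) by (metis Suc_leI mult_Suc_right add.commute mult_le_mono2)
      then have "e < g * D" using e(3) Eo_less[OF e(2)] by linarith
      then show "int e < p" using gD(1) by linarith
      obtain z where z: "vanishes (a k) e0 (w j0 z)" "\<not> p dvd taylor (a k) e0 (w j0 z)"
        using e(2) by (auto simp: Eo_def)
      define f where "f = [:- a k, 1:] ^ (g * j0) * w j0 z"
      have lin: "vanishes (a k) (g * j0) ([:- a k, 1:] ^ (g * j0))"
        by (simp add: vanishes_def taylor_linear_power)
      have "vanishes (a k) e f"
        unfolding f_def e(3) using lin z(1) by (rule vanishes_mult)
      moreover have "[taylor (a k) e f = taylor (a k) e0 (w j0 z)] (mod p)"
        using leading_taylor_mult[OF lin z(1)] unfolding f_def e(3) by (simp add: taylor_linear_power)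
      moreover have "null (\<Sum>s<n. q s * (euler ?P ^^ s) f)"
      proof -
        have "f = (\<Sum>j\<in>T j0. smult (z j) (h j * ?U j))"
          unfolding f_def w_def sum_distrib_left
          by (intro sum.cong) (auto simp: T_def radical_product_Suc mult_ac)
        then have "(\<Sum>s<n. q s * (euler ?P ^^ s) f)
            = (\<Sum>s<n. \<Sum>j\<in>T j0. smult (z j) (q s * (euler ?P ^^ s) (h j * ?U j)))"
          by (simp add: twisted_funpow_sum twisted_funpow_smult sum_distrib_left)
        also have "\<dots> = (\<Sum>j\<in>T j0. smult (z j) (\<Sum>s<n. q s * (euler ?P ^^ s) (h j * ?U j)))"
          by (subst sum.swap) (simp add: smult_sum_right)
        finally have eq: "(\<Sum>s<n. q s * (euler ?P ^^ s) f)
            = (\<Sum>j\<in>T j0. smult (z j) (\<Sum>s<n. q s * (euler ?P ^^ s) (h j * ?U j)))" .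
        show ?thesis
          unfolding eq
        proof (rule dvd_sum)
          fix j assume "j \<in> T j0"
          then show "null (smult (z j) (\<Sum>s<n. q s * (euler ?P ^^ s) (h j * ?U j)))"
            by (intro dvd_smult q(2)) (simp add: T_def)
        qed
      qed
      ultimately show "\<exists>f. vanishes (a k) e f \<and> \<not> p dvd taylor (a k) e f \<and>
         null (\<Sum>s<n. q s * (euler ?P ^^ s) f)"
        using z(2) cong_dvd_iff by blast
    qed
    moreover have "card E = (\<Sum>j0<D. card ((\<lambda>e. g * j0 + e) ` Eo j0))"
      unfolding E_def
    proof (rule card_UN_disjoint)
      show "\<forall>i\<in>{..<D}. \<forall>l\<in>{..<D}. i \<noteq> l \<longrightarrow> (\<lambda>e. g * i + e) ` Eo i \<inter> (\<lambda>e. g * l + e) ` Eo l = {}"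
      proof (intro ballI impI equals0I)
        fix i l x assume il: "i \<noteq> l" and "x \<in> (\<lambda>e. g * i + e) ` Eo i \<inter> (\<lambda>e. g * l + e) ` Eo l"
        then obtain e e' where e: "x = g * i + e" "x = g * l + e'" "e < g" "e' < g"
          using Eo_less by blast
        have "(g * i + e) div g = i" "(g * l + e') div g = l" using e(3,4) by simp_all
        then have "i = l" using e(1,2) by simp
        then show False using il by simp
      qed
    qed (simp_all add: finEo)
    moreover have "(\<Sum>j0<D. card ((\<lambda>e. g * j0 + e) ` Eo j0)) = (\<Sum>j0<D. card (Eo j0))"
      by (intro sum.cong card_image) auto
    moreover have "\<dots> \<ge> (\<Sum>j0<D. card (T j0))" by (intro sum_mono Eo)
    moreover have "(\<Sum>j0<D. card (T j0)) = card (\<Union>j0<D. T j0)"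
      by (intro card_UN_disjoint[symmetric]) (use Suc.prems(2) in \<open>auto simp: T_def\<close>)
    moreover have "(\<Union>j0<D. T j0) = S" using Suc.prems(5) by (auto simp: T_def)
    ultimately show False by (simp add: n_def)
  qed
qed

end

section \<open>Stepanov's method\<close>

context prime_modulus
begin

lemma fermat_int: "[x ^ nat p = x] (mod p)"
proof -
  define y where "y = nat (x mod p)"
  have y: "[x = int y] (mod p)" using p_gt_1 by (simp add: y_def unique_euclidean_semiring_class.cong_def)
  have p: "prime (nat p)" "int (nat p) = p" using prime_p p_gt_1 by (auto simp: prime_nat_iff_prime)
  have "[y ^ nat p = y] (mod nat p)"
  proof (cases "nat p dvd y")
    case True
    then have "nat p dvd y ^ nat p" using p(1) prime_gt_0_nat by (metis dvd_power_le dvd_refl power_one_right Suc_leI One_nat_def)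
    then show ?thesis using True by (simp add: unique_euclidean_semiring_class.cong_def mod_eq_0_iff_dvd)
  next
    case False
    then have "[y ^ (nat p - 1) * y = 1 * y] (mod nat p)"
      using fermat_theorem[OF p(1)] by (intro cong_mult) auto
    moreover have "y ^ (nat p - 1) * y = y ^ nat p"
      using p(1) prime_gt_0_nat by (metis power_minus_mult)
    ultimately show ?thesis by simp
  qed
  then have "[int y ^ nat p = int y] (mod p)"
    using p(2) by (metis cong_int_iff of_nat_power)
  then show ?thesis using y cong_pow[OF y, of "nat p"] by (meson cong_trans cong_sym)
qed

lemma degree_radical_product_le: "(\<And>i. i < k \<Longrightarrow> j i \<le> D) \<Longrightarrow> degree (radical_product a g k j) \<le> k * (g * D)"
proof (induction k)
  case (Suc k)
  have "g * j k \<le> g * D" using Suc.prems[of k] by (intro mult_le_mono2) simp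
  then have "degree ([:- a k, 1:] ^ (g * j k)) \<le> g * D"
    using degree_power_le[of "[:- a k, 1:]" "g * j k"] by (auto elim: order.trans)
  then show ?case
    using degree_mult_le[of "[:- a k, 1:] ^ (g * j k)" "radical_product a g k j"] Suc
    unfolding radical_product_Suc by fastforce
qed (simp add: radical_product_def)

lemma null_pderiv_power_p: "null (pderiv (f ^ (nat p * m)))"
proof (cases "nat p * m")
  case (Suc l)
  have "int (Suc l) = p * int m" using Suc p_gt_1 by (metis int_nat_eq less_imp_le of_nat_mult order.strict_trans zero_less_one)
  then show ?thesis
    unfolding Suc pderiv_power_Suc by (simp add: const_poly_dvd_iff del: of_nat_Suc)
qed (simp only: power_0 pderiv_1 dvd_0_right)

text \<open>
  The auxiliary polynomial \<open>F\<close> vanishes to order \<open>M\<close> at every point of \<open>X\<close>, whereas its degree is only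
  about \<open>p * c\<close>, which forces \<open>card X\<close> to be at most about \<open>p * c / M\<close>. The vanishing costs \<open>M\<close> equations per
  coefficient of a polynomial of degree about \<open>A\<close>, because on \<open>X\<close> the power \<open>(x - a i)^(g * j i)\<close> equals
  the constant \<open>\<omega> i ^ j i\<close> and \<open>(x - b)^(p * m)\<close> equals \<open>(x - b)^m\<close>. With \<open>n * (c + 1) * A\<close> unknowns available,
  the order \<open>M = n * c\<close> is affordable once \<open>A\<close> is large compared with \<open>M\<close>. The powers of \<open>x - b\<close>
  separate the contributions of different \<open>m\<close> at the point \<open>b\<close>, which reduces the nonvanishing of \<open>F\<close> to
  the independence of the products of radicals.
\<close>

lemma stepanov:
  fixes a \<omega> :: "nat \<Rightarrow> int"
  assumes gD: "int (g * D) = p - 1"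
    and distinct: "\<And>i l. i < \<kappa> \<Longrightarrow> l < \<kappa> \<Longrightarrow> i \<noteq> l \<Longrightarrow> \<not> p dvd a i - a l"
    and b: "\<And>i. i < \<kappa> \<Longrightarrow> \<not> p dvd b - a i"
    and n: "n = D ^ \<kappa>" and A: "A = (\<kappa> + 1) * n * (c + 1) ^ 2"
    and K: "n * (A + \<kappa> * n + 1) + A + \<kappa> * n + n \<le> g"
    and X: "X \<subseteq> {0..<p}" "\<And>x i. x \<in> X \<Longrightarrow> i < \<kappa> \<Longrightarrow> [(x - a i) ^ g = \<omega> i] (mod p)"
    and \<omega>: "\<And>i. i < \<kappa> \<Longrightarrow> \<not> p dvd \<omega> i"
  shows "card X * (n * c) \<le> A + nat p * c + \<kappa> * nat p"
proof (rule ccontr)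
  assume contra: "\<not> card X * (n * c) \<le> A + nat p * c + \<kappa> * nat p"
  define M where "M = n * c"
  define J where "J = {..<\<kappa>} \<rightarrow>\<^sub>E {..<D}"
  define I where "I = J \<times> {..c} \<times> {..<A}"
  define P where "P = root_product a \<kappa>"
  define r where "r = log_deriv a g \<kappa>"
  define U where "U = radical_product a g \<kappa>"
  define V where "V = (\<lambda>j m. [:-b, 1:] ^ (nat p * m) * U j)"
  define G where "G = (\<lambda>s (j, m, t). smult (\<Prod>i<\<kappa>. \<omega> i ^ j i) ([:-b, 1:] ^ m * (twisted P (r j) ^^ s) (monom 1 t)))"
  have "g > 0" "D > 0" using gD p_gt_1 by (auto intro: Nat.gr0I)
  then have n_pos: "n > 0" using n by simp
  have g_less: "int g < p"
  proof -
    have "g \<le> g * D" using \<open>D > 0\<close> by simp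
    then show ?thesis using gD by linarith
  qed
  have cardJ: "card J = n" by (simp add: J_def n card_PiE)
  have finJ: "finite J" unfolding J_def by (intro finite_PiE) auto
  have jD: "j i < D" if "j \<in> J" "i < \<kappa>" for j i using that by (auto simp: J_def PiE_iff)
  have "card {..<M} * (A + \<kappa> * M + c + 1) < card I"
  proof -
    have "c * (\<kappa> * n * c + (c + 1)) < A"
    proof -
      have "(c + 1) ^ 2 * (\<kappa> * n) \<ge> c * c * (\<kappa> * n)"
        by (intro mult_le_mono) (auto simp: power2_eq_square)
      moreover have "n * (c + 1) ^ 2 \<ge> 1 * (c + 1) ^ 2" using n_pos by (intro mult_le_mono) auto
      moreover have "A = (c + 1) ^ 2 * (\<kappa> * n) + n * (c + 1) ^ 2" by (simp add: A algebra_simps)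
      moreover have "c * (\<kappa> * n * c + (c + 1)) = c * c * (\<kappa> * n) + c * (c + 1)"
        by (simp add: algebra_simps)
      moreover have "c * (c + 1) < (c + 1) ^ 2" by (simp add: power2_eq_square)
      ultimately show ?thesis by linarith
    qed
    then have "c * (A + \<kappa> * n * c + c + 1) < (c + 1) * A" by (simp add: algebra_simps)
    then have "n * (c * (A + \<kappa> * n * c + c + 1)) < n * ((c + 1) * A)" using n_pos by simp
    moreover have "card I = n * ((c + 1) * A)"
      by (simp only: I_def card_cartesian_product cardJ card_atMost card_lessThan Suc_eq_plus1)
    moreover have "card {..<M} * (A + \<kappa> * M + c + 1) = n * (c * (A + \<kappa> * n * c + c + 1))"
      by (simp only: M_def card_lessThan mult.assoc)
    ultimately show ?thesis by simp
  qed
  then obtain z where z: "\<exists>i\<in>I. \<not> p dvd z i" "\<And>s. s \<in> {..<M} \<Longrightarrow> null (\<Sum>i\<in>I. smult (z i) (G s i))"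
  proof (rule nontrivial_null_combinations[where G = G, rotated 3])
    show "finite I" using finJ by (simp add: I_def)
    show "degree (G s i) < A + \<kappa> * M + c + 1" if s: "s \<in> {..<M}" and i: "i \<in> I" for s i
    proof -
      obtain j m t where i': "i = (j, m, t)" "m \<le> c" "t < A" using i by (auto simp: I_def)
      have "degree ((twisted P (r j) ^^ s) (monom 1 t)) \<le> degree (monom (1::int) t) + \<kappa> * s"
        unfolding P_def r_def by (intro degree_twisted_funpow degree_root_product degree_log_deriv)
      also have "\<dots> \<le> A + \<kappa> * M" using s i' by (intro add_mono mult_le_mono) (auto simp: degree_monom_eq)
      finally have "degree ([:-b, 1:] ^ m * (twisted P (r j) ^^ s) (monom 1 t)) \<le> m + (A + \<kappa> * M)"
        using degree_power_le[of "[:-b, 1:]" m]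
        by (intro order.trans[OF degree_mult_le] add_mono) auto
      then have "degree (G s i) \<le> m + (A + \<kappa> * M)"
        unfolding G_def i' using degree_smult_le order.trans by auto
      then show ?thesis using i' by simp
    qed
  qed auto
  define F where "F = (\<Sum>(j, m, t)\<in>I. smult (z (j, m, t)) (monom 1 t * V j m))"
  define h where "h = (\<lambda>m j. \<Sum>t<A. monom (z (j, m, t)) t)"
  define R where "R = (\<lambda>m. \<Sum>j\<in>J. h m j * U j)"
  have coeff_h: "coeff (h m j) t = z (j, m, t)" if "t < A" for m j t
    using that by (simp add: h_def coeff_sum)
  have F_R: "F = (\<Sum>m\<le>c. [:-b, 1:] ^ (nat p * m) * R m)"
  proof -
    have "F = (\<Sum>j\<in>J. \<Sum>m\<le>c. \<Sum>t<A. smult (z (j, m, t)) (monom 1 t * V j m))"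
      unfolding F_def I_def by (simp add: sum.cartesian_product)
    also have "\<dots> = (\<Sum>j\<in>J. \<Sum>m\<le>c. h m j * V j m)"
      by (simp add: h_def sum_distrib_right smult_monom flip: mult_smult_left)
    also have "\<dots> = (\<Sum>m\<le>c. [:-b, 1:] ^ (nat p * m) * R m)"
      by (subst sum.swap) (simp add: V_def R_def sum_distrib_left sum_distrib_right mult_ac)
    finally show ?thesis .
  qed

  have not_null_F: "\<not> null F"
  proof
    assume "null F"
    obtain j m t where "j \<in> J" "m \<le> c" "t < A" "\<not> p dvd z (j, m, t)" using z(1) by (auto simp: I_def)
    then have ex: "\<exists>m. m \<le> c \<and> (\<exists>j\<in>J. \<not> null (h m j))"
      using coeff_h[of t m j] unfolding const_poly_dvd_iff by metis
    \<comment> \<open>the order of \<open>F\<close> at \<open>b\<close> is decided by the least \<open>m\<close> with a nonzero contribution, since that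
      contribution has order less than \<open>p\<close>\<close>
    define m0 where "m0 = (LEAST m. m \<le> c \<and> (\<exists>j\<in>J. \<not> null (h m j)))"
    have m0: "m0 \<le> c" "\<exists>j\<in>J. \<not> null (h m0 j)" using LeastI_ex[OF ex] by (auto simp: m0_def)
    have below: "null (h m j)" if "m < m0" "j \<in> J" for m j
      using not_less_Least[of m "\<lambda>m. m \<le> c \<and> (\<exists>j\<in>J. \<not> null (h m j))"] that m0(1) by (auto simp: m0_def)
    define S where "S = {j \<in> J. \<not> null (h m0 j)}"
    have "S \<subseteq> J" by (auto simp: S_def)
    have "\<not> vanishes b g (\<Sum>j\<in>S. h m0 j * radical_product a g \<kappa> j)"
    proof (rule radical_products_independent[OF gD order.refl distinct K order.refl])
      show "finite S" "card S \<le> n" using finJ \<open>S \<subseteq> J\<close> cardJ card_mono finite_subset by metis+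
      show "S \<noteq> {}" using m0(2) by (auto simp: S_def)
      show "j = j'" if "j \<in> S" "j' \<in> S" "\<And>i. i < \<kappa> \<Longrightarrow> j i = j' i" for j j'
      proof (rule PiE_ext)
        show "j \<in> {..<\<kappa>} \<rightarrow>\<^sub>E {..<D}" "j' \<in> {..<\<kappa>} \<rightarrow>\<^sub>E {..<D}"
          using that(1,2) \<open>S \<subseteq> J\<close> unfolding J_def by blast+
      qed (use that(3) in simp)
      show "degree (h m0 j) \<le> A" for j
        unfolding h_def by (intro degree_sum_le) (auto intro: order.trans[OF degree_monom_le])
    qed (use jD b \<open>S \<subseteq> J\<close> in \<open>auto simp: S_def\<close>)
    moreover have "null (R m0 - (\<Sum>j\<in>S. h m0 j * U j))"
    proof -
      have "R m0 = (\<Sum>j\<in>J - S. h m0 j * U j) + (\<Sum>j\<in>S. h m0 j * U j)"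
        unfolding R_def using finJ \<open>S \<subseteq> J\<close> by (rule sum.subset_diff[rotated])
      moreover have "null (\<Sum>j\<in>J - S. h m0 j * U j)"
        by (intro dvd_sum dvd_mult2) (auto simp: S_def)
      ultimately show ?thesis by simp
    qed
    ultimately have "\<not> vanishes b g (R m0)" using vanishes_cong_null unfolding U_def by blast
    then obtain e where e: "e < g" "vanishes b e (R m0)" "\<not> p dvd taylor b e (R m0)" by (rule exact_order)
    let ?l = "nat p * m0 + e"
    have lin: "vanishes b (nat p * m) ([:-b, 1:] ^ (nat p * m))" for m
      by (simp add: vanishes_def taylor_linear_power)
    have "[taylor b ?l ([:-b, 1:] ^ (nat p * m0) * R m0) = taylor b e (R m0)] (mod p)"
      using leading_taylor_mult[OF lin e(2)] by (simp add: taylor_linear_power)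
    then have "\<not> p dvd taylor b ?l ([:-b, 1:] ^ (nat p * m0) * R m0)" using e(3) cong_dvd_iff by blast
    moreover have "p dvd taylor b ?l (\<Sum>m\<in>{..c} - {m0}. [:-b, 1:] ^ (nat p * m) * R m)"
      unfolding taylor_sum
    proof (rule dvd_sum)
      fix m assume m: "m \<in> {..c} - {m0}"
      show "p dvd taylor b ?l ([:-b, 1:] ^ (nat p * m) * R m)"
      proof (cases "m < m0")
        case True
        then have "null (R m)" unfolding R_def using below by (intro dvd_sum dvd_mult2) auto
        then show ?thesis by (intro null_taylor dvd_mult)
      next
        case False
        then have "nat p * Suc m0 \<le> nat p * m" using m by (intro mult_le_mono) auto
        then have "?l < nat p * m" using e(1) g_less by simp
        then show ?thesis using vanishes_mult_right[OF lin, of m "R m"] by (simp add: vanishes_def)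
      qed
    qed
    moreover have "F = [:-b, 1:] ^ (nat p * m0) * R m0 + (\<Sum>m\<in>{..c} - {m0}. [:-b, 1:] ^ (nat p * m) * R m)"
      unfolding F_R using m0(1) by (intro sum.remove) auto
    moreover have "p dvd taylor b ?l F" using \<open>null F\<close> by (rule null_taylor)
    ultimately show False by (simp add: taylor_add dvd_add_left_iff)
  qed

  have V: "null (P * pderiv (V j m) - r j * V j m)" for j m
  proof -
    have "P * pderiv (V j m) - r j * V j m = P * U j * pderiv ([:-b, 1:] ^ (nat p * m))
        + [:-b, 1:] ^ (nat p * m) * (P * pderiv (U j) - r j * U j)"
      unfolding V_def pderiv_mult by (simp only: algebra_simps)
    then show ?thesis
      by (simp add: P_def U_def r_def pderiv_radical_product null_pderiv_power_p)
  qed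
  have "vanishes x M F" if x: "x \<in> X" for x
  proof (rule vanishes_by_values)
    show "\<not> p dvd poly P x"
      unfolding P_def
    proof (rule poly_root_product_nonzero)
      fix i assume i: "i < \<kappa>"
      show "\<not> p dvd x - a i"
      proof
        assume "p dvd x - a i"
        then have "p dvd (x - a i) ^ g" using \<open>g > 0\<close> by (metis dvd_power dvd_trans)
        then show False using X(2)[OF x i] \<omega>[OF i] cong_dvd_iff by blast
      qed
    qed
    have "M \<le> A"
    proof -
      have "n * c \<le> (\<kappa> + 1) * n * (c + 1) ^ 2"
        by (intro mult_le_mono) (auto simp: power2_eq_square)
      then show ?thesis by (simp add: M_def A)
    qed
    then have "M \<le> g" using K by linarith
    then show "int M \<le> p" using g_less by linarith
    fix s assume s: "s < M"
    have "[poly ((euler P ^^ s) F) x = poly (\<Sum>i\<in>I. smult (z i) (G s i)) x] (mod p)"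
    proof -
      have F: "(euler P ^^ s) F = (\<Sum>i\<in>I. smult (z i) (case i of (j, m, t) \<Rightarrow> (euler P ^^ s) (monom 1 t * V j m)))"
        unfolding F_def twisted_funpow_sum
        by (intro sum.cong) (auto simp: twisted_funpow_smult)
      show ?thesis
        unfolding F poly_sum poly_smult
      proof (intro cong_sum cong_mult cong_refl)
        fix i assume "i \<in> I"
        then obtain j m t where i: "i = (j, m, t)" by (cases i) auto
        let ?y = "poly ((twisted P (r j) ^^ s) (monom 1 t)) x"
        have 1: "[poly ((euler P ^^ s) (monom 1 t * V j m)) x = ?y * poly (V j m) x] (mod p)"
          using null_poly[OF euler_funpow_mult[OF V, of s "monom 1 t" j m], of x]
          by (simp add: cong_iff_dvd_diff)
        have "[(x - b) ^ (nat p * m) = (x - b) ^ m] (mod p)"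
          unfolding power_mult by (intro cong_pow fermat_int)
        moreover have "[poly (U j) x = (\<Prod>i<\<kappa>. \<omega> i ^ j i)] (mod p)"
          unfolding U_def radical_product_def poly_prod
        proof (rule cong_prod)
          fix i assume "i \<in> {..<\<kappa>}"
          then show "[poly ([:- a i, 1:] ^ (g * j i)) x = \<omega> i ^ j i] (mod p)"
            using X(2)[OF x] by (auto simp: poly_power power_mult intro: cong_pow)
        qed
        ultimately have "[?y * ((x - b) ^ (nat p * m) * poly (U j) x)
            = ?y * ((x - b) ^ m * (\<Prod>i<\<kappa>. \<omega> i ^ j i))] (mod p)"
          by (intro cong_mult cong_refl)
        then have 2: "[?y * poly (V j m) x = poly (G s (j, m, t)) x] (mod p)"
          by (simp add: V_def G_def poly_power mult_ac)
        show "[poly (case i of (j, m, t) \<Rightarrow> (euler P ^^ s) (monom 1 t * V j m)) x = poly (G s i) x] (mod p)"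
          unfolding i using cong_trans[OF 1 2] by simp
      qed
    qed
    moreover have "p dvd poly (\<Sum>i\<in>I. smult (z i) (G s i)) x" using z(2) s by (intro null_poly) simp
    ultimately show "p dvd poly ((euler P ^^ s) F) x" using cong_dvd_iff by blast
  qed
  moreover have "finite X" using X(1) finite_subset by blast
  moreover have "\<not> p dvd x - y" if "x \<in> X" "y \<in> X" "x \<noteq> y" for x y
  proof -
    have "0 \<le> x" "x < p" "0 \<le> y" "y < p" using X(1) that by auto
    then have "\<bar>x - y\<bar> < p" "x - y \<noteq> 0" using that by linarith+
    then show ?thesis using zdvd_imp_le[of p "\<bar>x - y\<bar>"] by auto
  qed
  moreover have "degree F < M * card X"
  proof -
    have "degree F \<le> A + nat p * c + \<kappa> * nat p"
      unfolding F_def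
    proof (rule degree_sum_le)
      show "finite I" using finJ by (simp add: I_def)
      fix i assume "i \<in> I"
      then obtain j m t where i: "i = (j, m, t)" "j \<in> J" "m \<le> c" "t < A" by (auto simp: I_def)
      have "g * D \<le> nat p" using gD by linarith
      moreover have "degree (U j) \<le> \<kappa> * (g * D)"
        unfolding U_def using jD[OF i(2)] by (intro degree_radical_product_le) (simp add: less_imp_le)
      ultimately have "degree (U j) \<le> \<kappa> * nat p"
        using mult_le_mono2 order.trans by blast
      moreover have "degree ([:-b, 1:] ^ (nat p * m)) \<le> nat p * c"
        using degree_power_le[of "[:-b, 1:]" "nat p * m"] i(3) by (auto elim: order.trans)
      ultimately have "degree (V j m) \<le> nat p * c + \<kappa> * nat p"
        unfolding V_def by (intro order.trans[OF degree_mult_le] add_mono) auto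
      then have "degree (monom 1 t * V j m) \<le> A + (nat p * c + \<kappa> * nat p)"
        using i(4) by (intro order.trans[OF degree_mult_le] add_mono) (auto simp: degree_monom_eq)
      then show "degree (case i of (j, m, t) \<Rightarrow> smult (z (j, m, t)) (monom 1 t * V j m)) \<le> A + nat p * c + \<kappa> * nat p"
        using i(1) degree_smult_le order.trans by fastforce
    qed
    then show ?thesis using contra by (simp add: M_def mult_ac)
  qed
  ultimately have "null F" by (intro too_many_zeros_null[of X M F])
  then show False using not_null_F by simp
qed

end

section \<open>Discrete logarithms of four shifted values\<close>

lemma discrete_log_exists:
  assumes "prime (p::nat)"
  obtains r ind where "\<not> p dvd r" "inj_on ind {0<..<p}"
    "\<And>x. x \<in> {0<..<p} \<Longrightarrow> ind x < p - 1"
    "\<And>x. x \<in> {0<..<p} \<Longrightarrow> [r ^ ind x = x] (mod p)"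
    "\<And>x. x \<in> {0<..<p} \<Longrightarrow> coprime (ind x) (p - 1) \<Longrightarrow> residue_primroot p x"
proof -
  have p: "p > 1" using assms prime_gt_1_nat by blast
  obtain r where r: "residue_primroot p r"
    using prime_primitive_root_exists[OF p assms] by auto
  have tot: "totient p = p - 1" "totatives p = {0<..<p}"
    by (rule totient_prime[OF assms], rule totatives_prime[OF assms])
  have bij: "bij_betw (\<lambda>i. r ^ i mod p) {..<p - 1} {0<..<p}"
    using residue_primroot_is_generator[OF p r] unfolding tot .
  have r_coprime: "coprime p r" "ord p r = p - 1"
    using r unfolding residue_primroot_def tot by blast+
  define ind where "ind = inv_into {..<p - 1} (\<lambda>i. r ^ i mod p)"
  have ind: "ind x \<in> {..<p - 1}" "r ^ ind x mod p = x" if "x \<in> {0<..<p}" for x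
    using bij_betw_apply[OF bij_betw_inv_into[OF bij] that] bij_betw_inv_into_right[OF bij that]
    unfolding ind_def by blast+
  show ?thesis
  proof
    show "\<not> p dvd r" using r_coprime(1) p by auto
    show "inj_on ind {0<..<p}" 
    proof (rule inj_onI)
      fix x y assume xy: "x \<in> {0<..<p}" "y \<in> {0<..<p}" "ind x = ind y"
      show "x = y" using ind(2)[OF xy(1)] ind(2)[OF xy(2)] unfolding xy(3) by (rule trans[OF sym])
    qed
    show "ind x < p - 1" if "x \<in> {0<..<p}" for x using ind(1)[OF that] by simp
    show "[r ^ ind x = x] (mod p)" if "x \<in> {0<..<p}" for x
      using ind(2)[OF that] that by (simp add: unique_euclidean_semiring_class.cong_def)
    show "residue_primroot p x" if x: "x \<in> {0<..<p}" and "coprime (ind x) (p - 1)" for x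
    proof -
      have "ord p (r ^ ind x) = p - 1"
        using that r_coprime by (simp add: ord_power coprime_commute)
      moreover have "coprime p (r ^ ind x)" using r_coprime(1) by simp
      ultimately have "residue_primroot p (r ^ ind x)"
        using p unfolding residue_primroot_def tot by simp
      then show ?thesis using ind(2)[OF x] residue_primroot_mod[of p "r ^ ind x"] by simp
    qed
  qed
qed

text \<open>
  Fixing the discrete logarithm of \<open>v i x\<close> modulo \<open>D\<close> fixes the power \<open>(x - a i)^g\<close>. The signs \<open>\<sigma> i\<close> allow for
  values of the form \<open>a i - x\<close>. The choice \<open>c = n^3\<close> makes the relative error \<open>5 / n^3\<close>, small
  enough to survive a summation over \<open>n\<close> classes.
\<close>

lemma few_in_one_class:
  fixes p g D n r :: nat and v :: "nat \<Rightarrow> nat \<Rightarrow> nat" and a :: "nat \<Rightarrow> nat" and \<sigma> :: "nat \<Rightarrow> int"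
  assumes p: "prime p" "g * D = p - 1" and n: "n = D ^ 4" and g: "50 * n ^ 8 \<le> g"
    and a: "\<And>i. i < 4 \<Longrightarrow> a i < p" "inj_on a {..<4}"
    and r: "\<not> p dvd r" and ind: "\<And>x. x \<in> {0<..<p} \<Longrightarrow> [r ^ ind x = x] (mod p)"
    and \<sigma>: "\<And>i. \<sigma> i \<in> {1, -1}"
    and X: "X \<subseteq> {0..<p}" "\<And>x i. x \<in> X \<Longrightarrow> i < 4 \<Longrightarrow> v i x \<in> {0<..<p}"
      "\<And>x i. x \<in> X \<Longrightarrow> i < 4 \<Longrightarrow> [int (v i x) = \<sigma> i * (int x - int (a i))] (mod int p)"
      "\<And>x i. x \<in> X \<Longrightarrow> i < 4 \<Longrightarrow> ind (v i x) mod D = c i"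
  shows "real (card X) \<le> real p / real n + 5 * real p / real n ^ 4"
proof -
  interpret prime_modulus "int p" using p(1) by unfold_locales simp
  have "p > 1" using p prime_gt_1_nat by blast
  then have "g > 0" "D > 0" using p(2) by (auto intro: Nat.gr0I)
  then have n_pos: "n \<ge> 1" using n by (simp add: Suc_le_eq)
  have g_le: "g < p"
  proof -
    have "g \<le> g * D" using \<open>D > 0\<close> by simp
    then show ?thesis using p(2) \<open>p > 1\<close> by linarith
  qed
  \<comment> \<open>the degree bound that \<open>stepanov\<close> prescribes for \<open>c = n^3\<close>\<close>
  define A where "A = (4 + 1) * n * (n ^ 3 + 1) ^ 2"
  have A: "A \<le> 20 * n ^ 7"
  proof -
    have "(n ^ 3 + 1) ^ 2 \<le> (2 * n ^ 3) ^ 2" using n_pos by (intro power_mono) auto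
    also have "(2 * n ^ 3) ^ 2 = 4 * n ^ 6" by (simp add: power_mult_distrib flip: power_mult)
    finally have "A \<le> (4 + 1) * n * (4 * n ^ 6)" unfolding A_def by (intro mult_le_mono2)
    also have "\<dots> = 20 * n ^ 7" by (simp add: power_numeral_reduce)
    finally show ?thesis .
  qed
  have n_le: "n ^ i \<le> n ^ j" if "i \<le> j" for i j using n_pos that by (intro power_increasing) auto
  have K: "n * (A + 4 * n + 1) + A + 4 * n + n \<le> g"
  proof -
    have "n * A \<le> n * (20 * n ^ 7)" using A by (intro mult_le_mono2)
    also have "n * (20 * n ^ 7) = 20 * n ^ 8" by (simp add: power_numeral_reduce)
    finally have "n * (A + 4 * n + 1) + A + 4 * n + n \<le> 20 * n ^ 8 + 4 * n ^ 2 + 20 * n ^ 7 + 6 * n ^ 1"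
      using A by (simp add: algebra_simps power2_eq_square)
    also have "\<dots> \<le> 50 * n ^ 8" using n_le[of 2 8] n_le[of 7 8] n_le[of 1 8] by simp
    finally show ?thesis using g by simp
  qed
  have distinct: "\<not> int p dvd int x - int y" if "x < p" "y < p" "x \<noteq> y" for x y
    using that zdvd_imp_le[of "int p" "\<bar>int x - int y\<bar>"] by auto
  have "card (a ` {..<4}) \<le> 4" using card_image_le[of "{..<4}" a] by simp
  moreover have "50 \<le> g" using g n_le[of 0 8] by simp
  ultimately have "\<not> {..<p} \<subseteq> a ` {..<4}"
    using card_mono[of "a ` {..<4}" "{..<p}"] g_le by auto
  then obtain b where b: "b < p" "b \<notin> a ` {..<4}" by blast
  have "card (int ` X) * (n * n ^ 3) \<le> A + nat (int p) * n ^ 3 + 4 * nat (int p)"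
  proof (rule stepanov[where a = "int \<circ> a" and \<omega> = "\<lambda>i. \<sigma> i ^ g * int r ^ (g * c i)" and b = "int b"
        and \<kappa> = 4 and D = D and g = g])
    show "int (g * D) = int p - 1" using p(2) \<open>p > 1\<close> by simp
    show "\<not> int p dvd (int \<circ> a) i - (int \<circ> a) l" if "i < 4" "l < 4" "i \<noteq> l" for i l
    proof -
      have "a i \<noteq> a l" using that inj_onD[OF a(2), of i l] by auto
      then show ?thesis using distinct[of "a i" "a l"] a(1) that by simp
    qed
    show "\<not> int p dvd int b - (int \<circ> a) i" if "i < 4" for i
    proof -
      have "b \<noteq> a i" using b(2) that by auto
      then show ?thesis using distinct[of b "a i"] a(1) b(1) that by simp
    qed
    show "n = D ^ 4" "A = (4 + 1) * n * (n ^ 3 + 1) ^ 2" by (fact n A_def)+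
    show "n * (A + 4 * n + 1) + A + 4 * n + n \<le> g" by (fact K)
    show "int ` X \<subseteq> {0..<int p}" using X(1) by auto
    show "\<not> int p dvd \<sigma> i ^ g * int r ^ (g * c i)" for i
    proof
      assume "int p dvd \<sigma> i ^ g * int r ^ (g * c i)"
      then have "int p dvd int r ^ (g * c i)"
        using \<sigma>[of i] by (cases "even g") auto
      then have "int p dvd int r" using prime_dvd_power[OF prime_p] by blast
      then show False using r by simp
    qed
    fix x' i assume "x' \<in> int ` X" and i: "i < (4::nat)"
    then obtain x where x: "x \<in> X" "x' = int x" by auto
    have \<sigma>2: "\<sigma> i * \<sigma> i = 1" using \<sigma>[of i] by auto
    have "[r ^ (g * ind (v i x)) = r ^ (g * c i)] (mod p)"
    proof -
      have "ind (v i x) = D * (ind (v i x) div D) + c i" using X(4)[OF x(1) i] by (metis mult_div_mod_eq)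
      then have "g * ind (v i x) = g * D * (ind (v i x) div D) + g * c i"
        by (metis distrib_left mult.assoc)
      then have "r ^ (g * ind (v i x)) = (r ^ (g * D)) ^ (ind (v i x) div D) * r ^ (g * c i)"
        by (simp only: power_add power_mult)
      moreover have "[(r ^ (g * D)) ^ (ind (v i x) div D) * r ^ (g * c i)
           = 1 ^ (ind (v i x) div D) * r ^ (g * c i)] (mod p)"
        using fermat_theorem[OF p(1) r] p(2) by (intro cong_mult cong_pow cong_refl) simp
      ultimately show ?thesis by simp
    qed
    moreover have "[r ^ (g * ind (v i x)) = v i x ^ g] (mod p)"
      using cong_pow[OF ind[OF X(2)[OF x(1) i]], of g] by (simp only: mult.commute[of g] power_mult)
    ultimately have "[v i x ^ g = r ^ (g * c i)] (mod p)"
      using cong_sym cong_trans by blast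
    then have "[int (v i x ^ g) = int (r ^ (g * c i))] (mod int p)"
      by (simp only: cong_int_iff)
    then have "[int (v i x) ^ g = int r ^ (g * c i)] (mod int p)" by simp
    moreover have "[\<sigma> i * int (v i x) = \<sigma> i * (\<sigma> i * (int x - int (a i)))] (mod int p)"
      using X(3)[OF x(1) i] by (rule cong_scalar_left)
    then have "[\<sigma> i * int (v i x) = int x - int (a i)] (mod int p)"
      using \<sigma>2 by (simp flip: mult.assoc)
    then have "[(int x - int (a i)) ^ g = \<sigma> i ^ g * int (v i x) ^ g] (mod int p)"
      using cong_pow[of _ _ "int p" g] by (simp only: cong_sym flip: power_mult_distrib)
    ultimately show "[(x' - (int \<circ> a) i) ^ g = \<sigma> i ^ g * int r ^ (g * c i)] (mod int p)"
      using x(2) by (auto intro: cong_trans cong_scalar_left)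
  qed
  then have main: "card X * n ^ 4 \<le> A + p * n ^ 3 + 4 * p"
    by (simp add: card_image power_numeral_reduce)
  moreover have "A \<le> p"
    using A g g_le n_le[of 7 8] by linarith
  ultimately have "card X * n ^ 4 \<le> p * n ^ 3 + 5 * p" by linarith
  then have "real (card X) * real n ^ 4 \<le> real p * real n ^ 3 + 5 * real p"
    by (metis (mono_tags, lifting) of_nat_add of_nat_le_iff of_nat_mult of_nat_numeral of_nat_power)
  then have "real (card X) \<le> (real p * real n ^ 3 + 5 * real p) / real n ^ 4"
    using n_pos by (simp add: pos_le_divide_eq)
  also have "\<dots> = real p / real n + 5 * real p / real n ^ 4"
    using n_pos by (simp add: field_simps power_numeral_reduce)
  finally show ?thesis .
qed

lemma card_fibres_le:
  fixes u :: real
  assumes "finite T" "\<And>c. c \<in> T \<Longrightarrow> real (card {x \<in> X. f x = c}) \<le> u" "finite X"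
  shows "real (card {x \<in> X. f x \<in> T}) \<le> card T * u"
proof -
  have "{x \<in> X. f x \<in> T} = (\<Union>c\<in>T. {x \<in> X. f x = c})" by auto
  then have "card {x \<in> X. f x \<in> T} \<le> (\<Sum>c\<in>T. card {x \<in> X. f x = c})"
    using card_UN_le[OF assms(1)] by simp
  then have "real (card {x \<in> X. f x \<in> T}) \<le> (\<Sum>c\<in>T. real (card {x \<in> X. f x = c}))"
    unfolding of_nat_sum[symmetric] of_nat_le_iff .
  also have "\<dots> \<le> (\<Sum>c\<in>T. u)" by (rule sum_mono) (rule assms(2))
  finally show ?thesis by simp
qed

section \<open>The sieve\<close>

lemma card_coprime_below: "d \<ge> 2 \<Longrightarrow> card {c. c < d \<and> coprime c d} = totient d"
proof -
  assume d: "d \<ge> 2"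
  have "{c. c < d \<and> coprime c d} = totatives d"
    using d by (auto simp: totatives_def intro!: Nat.gr0I order.not_eq_order_implies_strict)
  then show ?thesis by (simp add: totient_def)
qed

lemma card_coprime_below_mult_le:
  assumes "d \<ge> 2"
  shows "card {c. c < d * l \<and> coprime c d} \<le> l * totient d"
proof -
  have "card {c. c < d * l \<and> coprime c d} \<le> card ({..<l} \<times> {c. c < d \<and> coprime c d})"
  proof (rule card_inj_on_le)
    show "inj_on (\<lambda>c. (c div d, c mod d)) {c. c < d * l \<and> coprime c d}"
      by (rule inj_onI) (metis Pair_inject div_mult_mod_eq)
    show "(\<lambda>c. (c div d, c mod d)) ` {c. c < d * l \<and> coprime c d} \<subseteq> {..<l} \<times> {c. c < d \<and> coprime c d}"
      using assms by (auto simp: less_mult_imp_div_less mult.commute)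
  qed simp
  then show ?thesis using card_coprime_below[OF assms] by (simp add: card_cartesian_product)
qed

lemma card_coprime_multiples_le:
  assumes "d \<ge> 2"
  shows "card {c. c < d * l \<and> coprime c d \<and> l dvd c} \<le> totient d"
proof -
  have "{c. c < d * l \<and> coprime c d \<and> l dvd c} \<subseteq> (\<lambda>k. l * k) ` {c. c < d \<and> coprime c d}"
    by (auto elim!: dvdE simp: mult.commute[of _ l])
  then have "card {c. c < d * l \<and> coprime c d \<and> l dvd c} \<le> card {c. c < d \<and> coprime c d}"
    by (rule surj_card_le[rotated]) simp
  then show ?thesis using card_coprime_below[OF assms] by simp
qed

text \<open>
  The values \<open>v i x\<close> represent \<open>\<plusminus> (x - a i)\<close> for \<open>i < 4\<close>, and \<open>ind\<close> is the discrete logarithm to base \<open>r\<close>.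
  Only the \<open>x\<close> with all four values nonzero are considered.
\<close>

locale shifted_logs =
  fixes p r :: nat and ind :: "nat \<Rightarrow> nat" and v :: "nat \<Rightarrow> nat \<Rightarrow> nat"
    and a :: "nat \<Rightarrow> nat" and \<sigma> :: "nat \<Rightarrow> int" and X :: "nat set"
  assumes p: "prime p"
    and a: "\<And>i. i < 4 \<Longrightarrow> a i < p" "inj_on a {..<4}"
    and r: "\<not> p dvd r" and ind: "\<And>x. x \<in> {0<..<p} \<Longrightarrow> [r ^ ind x = x] (mod p)"
    and ind_inj: "inj_on ind {0<..<p}" and ind_less: "\<And>x. x \<in> {0<..<p} \<Longrightarrow> ind x < p - 1"
    and \<sigma>: "\<And>i. \<sigma> i \<in> {1, -1}"
    and X: "X = {..<p} - a ` {..<4}"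
    and v: "\<And>x i. x \<in> X \<Longrightarrow> i < 4 \<Longrightarrow> v i x \<in> {0<..<p}"
    and v_cong: "\<And>x i. x \<in> X \<Longrightarrow> i < 4 \<Longrightarrow> [int (v i x) = \<sigma> i * (int x - int (a i))] (mod int p)"
begin

lemma finite_X: "finite X" by (simp add: X)

lemma card_X: "real (card X) \<ge> real p - 4"
proof -
  have "card {..<p} - card (a ` {..<4}) \<le> card X" unfolding X by (rule diff_card_le_card_Diff) simp
  moreover have "card (a ` {..<4}) \<le> 4" using card_image_le[of "{..<4}" a] by simp
  ultimately have "p \<le> card X + 4" by simp
  then show ?thesis by linarith
qed

lemma v_inj: "i < 4 \<Longrightarrow> inj_on (v i) X"
proof (rule inj_onI)
  fix x y assume i: "i < 4" and xy: "x \<in> X" "y \<in> X" "v i x = v i y"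
  have "[\<sigma> i * (int x - int (a i)) = \<sigma> i * (int y - int (a i))] (mod int p)"
    using v_cong[OF xy(1) i] v_cong[OF xy(2) i] xy(3) by (metis cong_sym cong_trans)
  then have "int p dvd \<sigma> i * (int x - int y)"
    by (simp add: cong_iff_dvd_diff algebra_simps)
  then have "int p dvd int x - int y" using \<sigma>[of i] by (auto simp: dvd_diff_commute)
  then have "[int x = int y] (mod int p)" by (simp add: cong_iff_dvd_diff)
  then have "[x = y] (mod p)" by (simp only: cong_int_iff)
  then show "x = y" using xy(1,2) X by (auto simp: unique_euclidean_semiring_class.cong_def)
qed

definition log_class :: "nat \<Rightarrow> nat \<Rightarrow> nat \<Rightarrow> nat" where
  "log_class D x = (\<lambda>i\<in>{..<4}. ind (v i x) mod D)"

lemma class_upper: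
  assumes D: "D dvd p - 1" "50 * D ^ 33 \<le> p - 1" and T: "finite T"
  shows "real (card {x \<in> X. log_class D x \<in> T}) \<le> card T * (real p / real D ^ 4 + 5 * real p / real D ^ 16)"
proof (rule card_fibres_le[OF T _ finite_X])
  fix c assume "c \<in> T"
  define g where "g = (p - 1) div D"
  have p1: "p > 1" using p prime_gt_1_nat by blast
  have g: "g * D = p - 1" using D by (simp add: g_def)
  then have "D > 0" using p1 by (auto intro: Nat.gr0I)
  have "50 * D ^ 32 * D \<le> g * D" using D(2) g by (simp add: power_numeral_reduce mult_ac)
  then have "50 * D ^ 32 \<le> g" using \<open>D > 0\<close> by simp
  then have "50 * (D ^ 4) ^ 8 \<le> g" by (simp flip: power_mult)
  then have "real (card {x \<in> X. log_class D x = c}) \<le> p / real (D ^ 4) + 5 * real p / real (D ^ 4) ^ 4"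
  proof (rule few_in_one_class[OF p g refl _ a r ind \<sigma>, where v = v and c = c])
    show "{x \<in> X. log_class D x = c} \<subseteq> {0..<p}" using X by auto
    show "ind (v i x) mod D = c i" if "x \<in> {x \<in> X. log_class D x = c}" "i < 4" for x i
      using that by (auto simp: log_class_def)
  qed (use v v_cong in auto)
  then show "real (card {x \<in> X. log_class D x = c}) \<le> real p / real D ^ 4 + 5 * real p / real D ^ 16"
    by (simp flip: power_mult)
qed

text \<open>
  Complement of \<open>class_upper\<close>: the classes outside \<open>T\<close> cannot contain more than their share of the
  \<open>p - 4\<close> elements of \<open>X\<close>. The summation over up to \<open>D^4\<close> classes turns the error \<open>5 * p / D^16\<close> into
  \<open>5 * p / D^12\<close>.
\<close>

lemma class_lower:
  assumes D: "D dvd p - 1" "50 * D ^ 33 \<le> p - 1" and T: "T \<subseteq> {..<4} \<rightarrow>\<^sub>E {..<D}"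
  shows "real (card {x \<in> X. log_class D x \<in> T}) \<ge> card T * (real p / real D ^ 4) - 4 - 5 * real p / real D ^ 12"
proof -
  let ?J = "{..<4::nat} \<rightarrow>\<^sub>E {..<D}"
  have p1: "p > 1" using p prime_gt_1_nat by blast
  have "D > 0" using D(1) p1 by (auto intro: Nat.gr0I)
  have finJ: "finite ?J" by (intro finite_PiE) auto
  have cardJ: "card ?J = D ^ 4" by (simp add: card_PiE)
  have "log_class D x \<in> ?J" for x using \<open>D > 0\<close> by (auto simp: log_class_def)
  then have "card X = card ({x \<in> X. log_class D x \<in> T} \<union> {x \<in> X. log_class D x \<in> ?J - T})"
    by (intro arg_cong[of _ _ card]) blast
  also have "\<dots> \<le> card {x \<in> X. log_class D x \<in> T} + card {x \<in> X. log_class D x \<in> ?J - T}"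
    by (rule card_Un_le)
  finally have "real (card X) \<le> real (card {x \<in> X. log_class D x \<in> T}) + real (card {x \<in> X. log_class D x \<in> ?J - T})"
    by linarith
  moreover have "real (card {x \<in> X. log_class D x \<in> ?J - T}) \<le> card (?J - T) * (real p / real D ^ 4 + 5 * real p / real D ^ 16)"
    using finJ by (intro class_upper D) auto
  ultimately have "real p - 4 \<le> real (card {x \<in> X. log_class D x \<in> T}) + card (?J - T) * (real p / real D ^ 4 + 5 * real p / real D ^ 16)"
    using card_X by linarith
  moreover have "real (card (?J - T)) = real D ^ 4 - real (card T)"
    using card_Diff_subset[OF finite_subset[OF T finJ] T] card_mono[OF finJ T] cardJ by simp
  moreover have "(real D ^ 4 - real (card T)) * (real p / real D ^ 4 + 5 * real p / real D ^ 16)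
      \<le> real p + 5 * real p / real D ^ 12 - card T * (real p / real D ^ 4)"
  proof -
    have ring: "(y - t) * (u + w) = y * u + y * w - t * u - t * w" for y t u w :: real
      by (simp add: algebra_simps)
    have "(real D ^ 4 - real (card T)) * (real p / real D ^ 4 + 5 * real p / real D ^ 16)
      = real D ^ 4 * (real p / real D ^ 4) + real D ^ 4 * (5 * real p / real D ^ 16) - card T * (real p / real D ^ 4) - card T * (5 * real p / real D ^ 16)"
      by (rule ring)
    also have "real D ^ 4 * (real p / real D ^ 4) = real p" using \<open>D > 0\<close> by simp
    also have "real D ^ 4 * (5 * real p / real D ^ 16) = 5 * real p / real D ^ 12"
      using \<open>D > 0\<close> by (simp add: field_simps flip: power_add)
    finally show ?thesis by simp
  qed
  ultimately show ?thesis by simp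
qed

lemma multiples_upper:
  assumes "l dvd p - 1" "i < 4"
  shows "real (card {x \<in> X. l dvd ind (v i x)}) \<le> real p / real l"
proof -
  have p1: "p > 1" using p prime_gt_1_nat by blast
  then have l: "l > 0" using assms(1) by (auto intro: Nat.gr0I)
  have "card {x \<in> X. l dvd ind (v i x)} \<le> card ((\<lambda>k. l * k) ` {..<(p - 1) div l})"
  proof (rule card_inj_on_le)
    show "inj_on (\<lambda>x. ind (v i x)) {x \<in> X. l dvd ind (v i x)}"
      using v_inj[OF assms(2)] ind_inj v[OF _ assms(2)] by (auto simp: inj_on_def)
    show "(\<lambda>x. ind (v i x)) ` {x \<in> X. l dvd ind (v i x)} \<subseteq> (\<lambda>k. l * k) ` {..<(p - 1) div l}"
    proof clarify
      fix x assume x: "x \<in> X" "l dvd ind (v i x)"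
      then obtain k where k: "ind (v i x) = l * k" by (elim dvdE)
      have "l * k < l * ((p - 1) div l)" using ind_less[OF v[OF x(1) assms(2)]] k assms(1) by simp
      then show "ind (v i x) \<in> (\<lambda>k. l * k) ` {..<(p - 1) div l}" using k by simp
    qed
  qed simp
  also have "\<dots> \<le> (p - 1) div l" using card_image_le[of "{..<(p - 1) div l}"] by simp
  finally have "real (card {x \<in> X. l dvd ind (v i x)}) \<le> real ((p - 1) div l)" by simp
  also have "\<dots> \<le> real (p - 1) / real l" by (rule of_nat_div_le_of_nat)
  also have "\<dots> \<le> real p / real l" by (intro divide_right_mono) auto
  finally show ?thesis .
qed

lemma coprime_class:
  assumes "i < 4"
  shows "coprime (log_class (d * l) x i) d \<longleftrightarrow> coprime (ind (v i x)) d"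
proof -
  have "log_class (d * l) x i mod d = ind (v i x) mod d"
    using assms by (simp add: log_class_def mod_mod_cancel)
  then show ?thesis using gcd_red_nat by (metis coprime_iff_gcd_eq_1 gcd.commute)
qed

text \<open>
  Of the \<open>(d * l)^4\<close> classes modulo \<open>d * l\<close> at most \<open>totient d * (l * totient d)^3\<close> are relevant. As \<open>d * l \<ge> 2\<close>,
  the error term in \<open>class_upper\<close> at most doubles the count.
\<close>

lemma sieved_medium_upper:
  assumes d: "d \<ge> 2" "d * l dvd p - 1" "50 * (d * l) ^ 33 \<le> p - 1" and l: "l > 0" and i: "i < 4"
  shows "real (card {x \<in> X. (\<forall>i<4. coprime (ind (v i x)) d) \<and> l dvd ind (v i x)})
    \<le> 2 * (real (totient d) / real d) ^ 4 * real p / real l"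
proof -
  let ?D = "d * l"
  define T where "T = (\<lambda>k. if k = i then {c. c < ?D \<and> coprime c d \<and> l dvd c} else {c. c < ?D \<and> coprime c d})"
  have finT: "finite (PiE {..<4} T)" by (intro finite_PiE) (auto simp: T_def)
  have "card (PiE {..<4} T) = (\<Prod>k<4. card (T k))" by (simp add: card_PiE)
  also have "\<dots> = card (T i) * (\<Prod>k\<in>{..<4} - {i}. card (T k))" using i by (intro prod.remove) auto
  also have "\<dots> \<le> totient d * (\<Prod>k\<in>{..<4} - {i}. l * totient d)"
  proof (intro mult_mono prod_mono)
    show "card (T i) \<le> totient d" using card_coprime_multiples_le[OF d(1)] by (simp add: T_def)
    show "0 \<le> card (T k) \<and> card (T k) \<le> l * totient d" if "k \<in> {..<4} - {i}" for k
      using card_coprime_below_mult_le[OF d(1)] that by (simp add: T_def)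
  qed auto
  also have "\<dots> = totient d ^ 4 * l ^ 3" using i by (simp add: power_mult_distrib power_numeral_reduce)
  finally have cardT: "real (card (PiE {..<4} T)) \<le> real (totient d) ^ 4 * real l ^ 3"
    by (simp flip: of_nat_mult of_nat_power)
  have "{x \<in> X. (\<forall>i<4. coprime (ind (v i x)) d) \<and> l dvd ind (v i x)} \<subseteq> {x \<in> X. log_class ?D x \<in> PiE {..<4} T}"
  proof clarify
    fix x assume x: "x \<in> X" "\<forall>i<4. coprime (ind (v i x)) d" "l dvd ind (v i x)"
    show "log_class ?D x \<in> PiE {..<4} T"
    proof
      fix k assume k: "k \<in> {..<4::nat}"
      have "log_class ?D x k < ?D" using k d l by (simp add: log_class_def)
      moreover have "coprime (log_class ?D x k) d" using coprime_class k x by simp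
      moreover have "l dvd log_class ?D x i" using x(3) i by (simp add: log_class_def dvd_mod)
      ultimately show "log_class ?D x k \<in> T k" by (auto simp: T_def)
    qed (simp add: log_class_def)
  qed
  then have "card {x \<in> X. (\<forall>i<4. coprime (ind (v i x)) d) \<and> l dvd ind (v i x)} \<le> card {x \<in> X. log_class ?D x \<in> PiE {..<4} T}"
    by (intro card_mono) (use finite_X in auto)
  then have "real (card {x \<in> X. (\<forall>i<4. coprime (ind (v i x)) d) \<and> l dvd ind (v i x)})
     \<le> card (PiE {..<4} T) * (real p / real ?D ^ 4 + 5 * real p / real ?D ^ 16)"
    using class_upper[OF d(2,3) finT] by linarith
  also have "\<dots> \<le> (real (totient d) ^ 4 * real l ^ 3) * (2 * (real p / real ?D ^ 4))"
  proof (rule mult_mono[OF cardT])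
    have "2 * 1 \<le> ?D" using d(1) l by (intro mult_le_mono) auto
    then have D2: "real ?D \<ge> 2" by linarith
    then have "5 \<le> real ?D ^ 12" using power_mono[of 2 "real ?D" 12] by simp
    then have "5 * real p / real ?D ^ 16 \<le> real ?D ^ 12 * real p / real ?D ^ 16"
      by (intro divide_right_mono mult_right_mono) auto
    also have "\<dots> = real p / real ?D ^ 4" 
    proof -
      have "y ^ 12 * q / y ^ 16 = q / y ^ 4" if "y \<ge> 2" for y q :: real
        using that by (simp add: field_simps flip: power_add)
      then show ?thesis using D2 by blast
    qed
    finally show "real p / real ?D ^ 4 + 5 * real p / real ?D ^ 16 \<le> 2 * (real p / real ?D ^ 4)" by simp
  qed auto
  also have "\<dots> = 2 * (real (totient d) / real d) ^ 4 * real p / real l"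
    using d(1) l by (simp add: field_simps power_numeral_reduce)
  finally show ?thesis .
qed

lemma sieved_small_lower:
  assumes d: "d \<ge> 2" "d dvd p - 1" "50 * d ^ 33 \<le> p - 1"
  shows "real (card {x \<in> X. \<forall>i<4. coprime (ind (v i x)) d}) \<ge> 9 / 10 * (real (totient d) / real d) ^ 4 * real p"
proof -
  define T where "T = {..<4::nat} \<rightarrow>\<^sub>E {c. c < d \<and> coprime c d}"
  have cardT: "card T = totient d ^ 4" using card_coprime_below[OF d(1)] by (simp add: T_def card_PiE)
  have eq: "{x \<in> X. \<forall>i<4. coprime (ind (v i x)) d} = {x \<in> X. log_class d x \<in> T}"
    using d(1) by (auto simp: T_def log_class_def PiE_iff)
  have "real (card {x \<in> X. log_class d x \<in> T}) \<ge> card T * (real p / real d ^ 4) - 4 - 5 * real p / real d ^ 12"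
    using d by (intro class_lower) (auto simp: T_def intro!: PiE_mono)
  moreover have "card T * (real p / real d ^ 4) = (real (totient d) / real d) ^ 4 * real p"
    by (simp add: cardT power_divide)
  moreover have "4 + 5 * real p / real d ^ 12 \<le> 1 / 10 * ((real (totient d) / real d) ^ 4 * real p)"
  proof -
    have d4: "real d ^ 4 > 0" using d(1) by simp
    have "2 ^ 8 \<le> real d ^ 8" using d(1) by (intro power_mono) auto
    then have "100 * (5 * real p / real d ^ 12) \<le> real d ^ 8 * (5 * real p / real d ^ 12)" by (intro mult_right_mono) auto
    also have "\<dots> = 5 * real p / real d ^ 4" using d4 by (simp add: field_simps flip: power_add)
    finally have 1: "5 * real p / real d ^ 12 \<le> 1 / 20 * (real p / real d ^ 4)" by simp
    have "2 * d ^ 4 \<le> d * d ^ 4" using d(1) by (intro mult_le_mono1)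
    also have "\<dots> = d ^ 5" by (simp flip: power_Suc)
    also have "\<dots> \<le> d ^ 33" using d(1) by (intro power_increasing) auto
    finally have "80 * d ^ 4 \<le> p" using d(3) by linarith
    then have "real (80 * d ^ 4) \<le> real p" by (simp only: of_nat_le_iff)
    then have 2: "4 \<le> 1 / 20 * (real p / real d ^ 4)" using d4 by (simp add: field_simps)
    have "totient d \<ge> 1" using d(1) by (simp add: Suc_le_eq)
    then have "1 \<le> real (totient d) ^ 4" by simp
    then have "1 * (real p / real d ^ 4) \<le> real (totient d) ^ 4 * (real p / real d ^ 4)" by (intro mult_right_mono) auto
    then show ?thesis using 1 2 by (simp add: power_divide)
  qed
  ultimately have "real (card {x \<in> X. log_class d x \<in> T}) \<ge> 9 / 10 * ((real (totient d) / real d) ^ 4 * real p)"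
    by linarith
  then show ?thesis unfolding eq by (simp only: mult.assoc)
qed

text \<open>
  In the application the elements of \<open>M\<close> are the prime divisors of \<open>p - 1\<close> of medium size and those of
  \<open>B\<close> the big ones. Each of them is excluded for four values.
\<close>

lemma sieve:
  assumes d: "d \<ge> 2" "d dvd p - 1" "50 * d ^ 33 \<le> p - 1"
    and M: "finite M" "\<And>l. l \<in> M \<Longrightarrow> l > 0 \<and> d * l dvd p - 1 \<and> 50 * (d * l) ^ 33 \<le> p - 1"
    and B: "finite B" "\<And>l. l \<in> B \<Longrightarrow> l dvd p - 1"
    and cover: "\<And>l. prime l \<Longrightarrow> l dvd p - 1 \<Longrightarrow> l dvd d \<or> l \<in> M \<or> l \<in> B"
  shows "real (card {x \<in> X. \<forall>i<4. coprime (ind (v i x)) (p - 1)})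
    \<ge> (9 / 10 - 8 * (\<Sum>l\<in>M. 1 / real l)) * (real (totient d) / real d) ^ 4 * real p - 4 * real p * (\<Sum>l\<in>B. 1 / real l)"
proof -
  let ?W = "(real (totient d) / real d) ^ 4"
  define G where "G = {x \<in> X. \<forall>i<4. coprime (ind (v i x)) d}"
  define H where "H = {x \<in> X. \<forall>i<4. coprime (ind (v i x)) (p - 1)}"
  define Md where "Md = (\<lambda>(l, i). {x \<in> X. (\<forall>i<4. coprime (ind (v i x)) d) \<and> l dvd ind (v i x)})"
  define Bd where "Bd = (\<lambda>(l, i). {x \<in> X. l dvd ind (v i x)})"
  have fin: "finite H" "finite (Md q)" "finite (Bd q)" for q
    using finite_X by (auto simp: H_def Md_def Bd_def split: prod.splits)
  have "G \<subseteq> H \<union> (\<Union>q\<in>M \<times> {..<4}. Md q) \<union> (\<Union>q\<in>B \<times> {..<4}. Bd q)"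
  proof
    fix x assume x: "x \<in> G"
    show "x \<in> H \<union> (\<Union>q\<in>M \<times> {..<4}. Md q) \<union> (\<Union>q\<in>B \<times> {..<4}. Bd q)"
    proof (cases "x \<in> H")
      case False
      then obtain i where i: "i < 4" "\<not> coprime (ind (v i x)) (p - 1)" using x by (auto simp: G_def H_def)
      then obtain l where l: "prime l" "l dvd ind (v i x)" "l dvd p - 1"
        by (metis coprime_iff_gcd_eq_1 dvd_gcdD1 dvd_gcdD2 prime_factor_nat)
      have "\<not> l dvd d" using l x i(1) by (auto simp: G_def dest: coprime_common_divisor_nat prime_gt_1_nat)
      have "x \<in> Md (l, i)" "x \<in> Bd (l, i)" using x l(2) by (simp_all add: G_def Md_def Bd_def)
      moreover have "l \<in> M \<or> l \<in> B" using cover[OF l(1,3)] \<open>\<not> l dvd d\<close> by simp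
      moreover have "(l, i) \<in> A \<times> {..<4}" if "l \<in> A" for A using that i(1) by simp
      ultimately show ?thesis by blast
    qed simp
  qed
  then have "card G \<le> card (H \<union> (\<Union>q\<in>M \<times> {..<4}. Md q) \<union> (\<Union>q\<in>B \<times> {..<4}. Bd q))"
    using fin M(1) B(1) by (intro card_mono) auto
  also have "\<dots> \<le> card H + card (\<Union>q\<in>M \<times> {..<4}. Md q) + card (\<Union>q\<in>B \<times> {..<4}. Bd q)"
    by (intro order.trans[OF card_Un_le] add_mono card_Un_le order.refl)
  also have "\<dots> \<le> card H + (\<Sum>q\<in>M \<times> {..<4}. card (Md q)) + (\<Sum>q\<in>B \<times> {..<4}. card (Bd q))"
    using M(1) B(1) by (intro add_mono card_UN_le) auto
  finally have "real (card G) \<le> real (card H) + (\<Sum>q\<in>M \<times> {..<4}. real (card (Md q)))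
      + (\<Sum>q\<in>B \<times> {..<4}. real (card (Bd q)))"
    by (simp flip: of_nat_sum of_nat_add)
  also have "(\<Sum>q\<in>M \<times> {..<4}. real (card (Md q))) \<le> (\<Sum>(l, i)\<in>M \<times> {..<4::nat}. 2 * ?W * real p / real l)"
    unfolding Md_def using M(2) d(1) by (intro sum_mono) (auto intro!: sieved_medium_upper)
  also have "\<dots> = 8 * (\<Sum>l\<in>M. 1 / real l) * ?W * real p"
    by (simp add: sum.cartesian_product[symmetric] sum_distrib_left sum_distrib_right mult_ac)
  also have "(\<Sum>q\<in>B \<times> {..<4}. real (card (Bd q))) \<le> (\<Sum>(l, i)\<in>B \<times> {..<4::nat}. real p / real l)"
    unfolding Bd_def using B(2) by (intro sum_mono) (auto intro!: multiples_upper)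
  also have "\<dots> = 4 * real p * (\<Sum>l\<in>B. 1 / real l)"
    by (simp add: sum.cartesian_product[symmetric] sum_distrib_left sum_distrib_right mult_ac)
  finally have "real (card G) \<le> real (card H) + 8 * (\<Sum>l\<in>M. 1 / real l) * ?W * real p + 4 * real p * (\<Sum>l\<in>B. 1 / real l)"
    by simp
  moreover have "real (card G) \<ge> 9 / 10 * ?W * real p"
    unfolding G_def by (rule sieved_small_lower[OF d])
  ultimately show ?thesis unfolding H_def[symmetric] by (simp add: algebra_simps)
qed

end

section \<open>Estimates of Chebyshev and Mertens\<close>

lemma prod_prime_powers_dvd:
  fixes m :: nat
  assumes "finite Q" "\<And>q. q \<in> Q \<Longrightarrow> prime q" "\<And>q. q \<in> Q \<Longrightarrow> q ^ e q dvd m"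
  shows "(\<Prod>q\<in>Q. q ^ e q) dvd m"
  using assms
proof (induction Q rule: finite_induct)
  case (insert q Q)
  have "coprime (q ^ e q) (\<Prod>q\<in>Q. q ^ e q)"
  proof (rule prod_coprime_right)
    fix l assume "l \<in> Q"
    then have "coprime q l" using insert.prems(1) insert.hyps by (metis insertCI primes_coprime)
    then show "coprime (q ^ e q) (l ^ e l)" by simp
  qed
  then show ?case using insert by (simp add: divides_mult)
qed simp

lemma prod_primes_dvd:
  fixes m :: nat
  assumes "finite Q" "\<And>q. q \<in> Q \<Longrightarrow> prime q" "\<And>q. q \<in> Q \<Longrightarrow> q dvd m"
  shows "\<Prod>Q dvd m"
  using prod_prime_powers_dvd[of Q "\<lambda>_. 1" m] assms by simp

definition primes_le :: "nat \<Rightarrow> nat set" where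
  "primes_le n = {q. prime q \<and> q \<le> n}"

lemma finite_primes_le [simp]: "finite (primes_le n)"
  by (rule finite_subset[of _ "{..n}"]) (auto simp: primes_le_def)

lemma primes_le_Suc:
  "primes_le (Suc n) = (if prime (Suc n) then insert (Suc n) (primes_le n) else primes_le n)"
  by (auto simp: primes_le_def le_Suc_eq)

lemma Suc_notin_primes_le: "Suc n \<notin> primes_le n"
  by (simp add: primes_le_def)

lemma central_binomial_le: "(2 * m + 1) choose m \<le> 4 ^ m"
proof -
  have "(2 * m + 1 choose m) + (2 * m + 1 choose Suc m) = (\<Sum>k\<in>{m, Suc m}. 2 * m + 1 choose k)" by simp
  also have "\<dots> \<le> (\<Sum>k\<le>2 * m + 1. 2 * m + 1 choose k)" by (rule sum_mono2) auto
  also have "\<dots> = 2 ^ (2 * m + 1)" by (rule choose_row_sum)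
  also have "\<dots> = 2 * 4 ^ m" by (simp add: power_mult)
  also have "2 * m + 1 choose Suc m = (2 * m + 1 choose m)"
    by (subst binomial_symmetric) auto
  finally show ?thesis by simp
qed

text \<open>
  Erdoes' induction: the primes between \<open>m + 2\<close> and \<open>2 * m + 1\<close> divide the binomial coefficient of
  \<open>2 * m + 1\<close> over \<open>m\<close>, which is at most \<open>4^m\<close>.
\<close>

lemma primorial_le: "\<Prod>(primes_le n) \<le> 4 ^ n"
proof (induction n rule: less_induct)
  case (less n)
  consider "n = 0" | "n = 1" | "n = 2" | "n > 2" "even n" | "n > 2" "odd n" by linarith
  then show ?case
  proof cases
    case 4
    then obtain k where k: "n = Suc k" by (cases n) auto
    have "\<not> prime n" using 4 prime_odd_nat by blast
    then have "\<Prod>(primes_le n) = \<Prod>(primes_le k)" by (simp add: k primes_le_Suc)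
    also have "\<dots> \<le> 4 ^ k" using less k by simp
    also have "\<dots> \<le> 4 ^ n" by (simp add: k)
    finally show ?thesis .
  next
    case 5
    then obtain m where m: "n = 2 * m + 1" by (elim oddE)
    then have "m \<ge> 1" using 5 by simp
    let ?Q = "{q. prime q \<and> m + 1 < q \<and> q \<le> n}"
    have finQ: "finite ?Q" by (rule finite_subset[of _ "{..n}"]) auto
    have "\<Prod>?Q dvd (n choose m)"
    proof (rule prod_primes_dvd[OF finQ])
      fix q assume q: "q \<in> ?Q"
      have "q dvd fact m * fact (n - m) * (n choose m)"
        using q binomial_fact_lemma[of m n] m prime_dvd_fact_iff[of q n] by auto
      then show "q dvd n choose m"
        using q m prime_dvd_fact_iff[of q m] prime_dvd_fact_iff[of q "n - m"]
        by (auto simp: prime_dvd_mult_iff)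
    qed auto
    then have "\<Prod>?Q \<le> n choose m" using m by (intro dvd_imp_le) auto
    also have "\<dots> \<le> 4 ^ m" using central_binomial_le m by simp
    finally have Q: "\<Prod>?Q \<le> 4 ^ m" .
    have "primes_le n = primes_le (m + 1) \<union> ?Q" using m by (auto simp: primes_le_def)
    moreover have "primes_le (m + 1) \<inter> ?Q = {}" by (auto simp: primes_le_def)
    ultimately have "\<Prod>(primes_le n) = \<Prod>(primes_le (m + 1)) * \<Prod>?Q"
      using finQ by (metis finite_primes_le prod.union_disjoint)
    also have "\<dots> \<le> 4 ^ (m + 1) * 4 ^ m"
      using less[of "m + 1"] \<open>m \<ge> 1\<close> m Q by (intro mult_mono) auto
    also have "\<dots> = 4 ^ n" unfolding m by (simp flip: power_add)
    finally show ?thesis .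
  next
    case 3
    have "primes_le 2 = {2}" by (auto simp: primes_le_def dest: prime_ge_2_nat)
    then show ?thesis using 3 by simp
  next
    case 2
    have "primes_le 1 = {}" by (auto simp: primes_le_def dest: prime_ge_2_nat)
    then show ?thesis using 2 by simp
  next
    case 1
    have "primes_le 0 = {}" by (auto simp: primes_le_def)
    then show ?thesis using 1 by simp
  qed
qed

lemma prime_power_dvd_fact: "q ^ (n div q) dvd fact n" if "q > 0" for q n :: nat
proof -
  have "q ^ k dvd fact n" if "k * q \<le> n" for k
    using that
  proof (induction k arbitrary: n)
    case (Suc k)
    have "q ^ k dvd fact (Suc k * q - 1)" using \<open>q > 0\<close> by (intro Suc.IH) simp
    moreover have "q dvd Suc k * q" by simp
    ultimately have "q * q ^ k dvd (Suc k * q) * fact (Suc k * q - 1)" by (rule mult_dvd_mono[rotated])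
    also have "\<dots> = fact (Suc k * q)" using \<open>q > 0\<close> by (subst (2) fact_reduce) auto
    also have "\<dots> dvd fact n" using Suc.prems by (rule fact_dvd)
    finally show ?case by simp
  qed simp
  then show ?thesis by simp
qed

text \<open>
  Half of Mertens' first theorem. A prime \<open>q\<close> divides \<open>n!\<close> at least \<open>n / q - 1\<close> times, and
  \<open>ln (n!) \<le> n * ln n\<close>; the primorial bound absorbs the terms \<open>- ln q\<close>.
\<close>

lemma sum_ln_over_primes_le:
  assumes "n \<ge> 1"
  shows "(\<Sum>q\<in>primes_le n. ln (real q) / real q) \<le> ln (real n) + ln 4"
proof -
  have pos: "q > 0" "ln (real q) \<ge> 0" if "q \<in> primes_le n" for q
    using that prime_gt_0_nat prime_gt_1_nat by (auto simp: primes_le_def dest: prime_gt_0_nat prime_ge_1_nat)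
  have "(\<Prod>q\<in>primes_le n. q ^ (n div q)) dvd fact n"
    by (rule prod_prime_powers_dvd) (auto simp: primes_le_def prime_gt_0_nat prime_power_dvd_fact)
  then have "(\<Prod>q\<in>primes_le n. q ^ (n div q)) \<le> fact n" by (intro dvd_imp_le) auto
  also have "fact n \<le> n ^ n" using fact_le_power[where 'a=nat, of n] by simp
  finally have "real (\<Prod>q\<in>primes_le n. q ^ (n div q)) \<le> real (n ^ n)" by (simp only: of_nat_le_iff)
  moreover have "(\<Prod>q\<in>primes_le n. q ^ (n div q)) > 0" using pos by (intro prod_pos) auto
  ultimately have "ln (real (\<Prod>q\<in>primes_le n. q ^ (n div q))) \<le> ln (real (n ^ n))"
    by (intro ln_mono) (simp_all only: of_nat_0_less_iff)
  then have 1: "(\<Sum>q\<in>primes_le n. real (n div q) * ln (real q)) \<le> n * ln (real n)"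
    using pos assms by (simp add: ln_prod ln_realpow)
  have "real (\<Prod>(primes_le n)) \<le> real (4 ^ n)" using primorial_le by (simp only: of_nat_le_iff)
  moreover have "\<Prod>(primes_le n) > 0" using pos by (intro prod_pos) auto
  ultimately have "ln (real (\<Prod>(primes_le n))) \<le> ln (real (4 ^ n))"
    by (intro ln_mono) (simp_all only: of_nat_0_less_iff)
  then have 2: "(\<Sum>q\<in>primes_le n. ln (real q)) \<le> n * ln 4"
    using pos by (simp add: ln_prod ln_realpow)
  have "real n * (\<Sum>q\<in>primes_le n. ln (real q) / real q) = (\<Sum>q\<in>primes_le n. real n / real q * ln (real q))"
    by (simp add: sum_distrib_left)
  also have "\<dots> \<le> (\<Sum>q\<in>primes_le n. (real (n div q) + 1) * ln (real q))"
  proof (intro sum_mono mult_right_mono)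
    fix q assume q: "q \<in> primes_le n"
    show "real n / real q \<le> real (n div q) + 1"
    proof -
      have "n \<le> (n div q + 1) * q"
        using dividend_less_div_times[of q n] pos(1)[OF q] by (simp add: add.commute)
      then have "real n \<le> (real (n div q) + 1) * real q"
        by (metis of_nat_1 of_nat_add of_nat_le_iff of_nat_mult)
      then show ?thesis using pos(1)[OF q] by (simp add: pos_divide_le_eq)
    qed
  qed (use pos in auto)
  also have "\<dots> \<le> real n * (ln (real n) + ln 4)" using 1 2 by (simp add: algebra_simps sum.distrib)
  finally show ?thesis using assms by simp
qed

text \<open>
  Half of Mertens' second theorem, by partial summation from the first. The bound for the first sum
  must have leading coefficient \<open>1\<close>, since this coefficient becomes the exponent of \<open>ln n\<close> in the product
  over primes below and finally the exponent \<open>4\<close> of \<open>ln (ln p)\<close>.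
\<close>

lemma sum_over_primes_le:
  assumes "n \<ge> 2"
  shows "(\<Sum>q\<in>primes_le n. 1 / real q) \<le> ln (ln (real n)) + (5 - ln (ln 2))"
proof -
  define A where "A = (\<lambda>n. \<Sum>q\<in>primes_le n. ln (real q) / real q)"
  define S where "S = (\<lambda>n. \<Sum>q\<in>primes_le n. 1 / real q)"
  let ?L = "\<lambda>n. ln (real n)"
  have primes2: "primes_le 2 = {2}" by (auto simp: primes_le_def dest: prime_ge_2_nat)
  have "S n - A n / ?L n \<le> ln (?L n) - ln (ln 2) + ln 4 * (1 / ln 2 - 1 / ?L n)"
    using assms
  proof (induction n rule: dec_induct)
    case base
    show ?case by (simp add: S_def A_def primes2)
  next
    case (step n)
    have L: "?L n > 0" "?L (Suc n) > 0" "?L n \<le> ?L (Suc n)" using step.hyps by auto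
    have "S (Suc n) - A (Suc n) / ?L (Suc n) = S n - A n / ?L (Suc n)"
      using L by (simp add: S_def A_def primes_le_Suc Suc_notin_primes_le add_divide_distrib)
    also have "\<dots> = (S n - A n / ?L n) + A n * (1 / ?L n - 1 / ?L (Suc n))"
      by (simp add: algebra_simps)
    also have "A n * (1 / ?L n - 1 / ?L (Suc n)) \<le> (?L n + ln 4) * (1 / ?L n - 1 / ?L (Suc n))"
      unfolding A_def using L step.hyps
      by (intro mult_right_mono sum_ln_over_primes_le) (auto simp: divide_left_mono)
    also have "\<dots> = (1 - ?L n / ?L (Suc n)) + ln 4 * (1 / ?L n - 1 / ?L (Suc n))"
      using L by (simp add: field_simps)
    also have "1 - ?L n / ?L (Suc n) \<le> ln (?L (Suc n)) - ln (?L n)"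
      using ln_le_minus_one[of "?L n / ?L (Suc n)"] L by (simp add: ln_div)
    finally show ?case using step.IH by (simp add: algebra_simps)
  qed
  moreover have "A n / ?L n \<le> 1 + ln 4 / ?L n"
    using sum_ln_over_primes_le[of n] assms by (simp add: A_def field_simps)
  moreover have "ln 4 / ln (2::real) = 2"
    using ln_realpow[of 2 2] by simp
  moreover have "ln 4 / ?L n \<ge> 0" using assms by simp
  ultimately show ?thesis unfolding S_def by (simp add: algebra_simps)
qed

lemma sum_inverse_squares_primes_le: "(\<Sum>q\<in>primes_le n. (1 / real q) ^ 2) \<le> 1"
proof -
  have "(\<Sum>q\<in>primes_le (Suc n). (1 / real q) ^ 2) \<le> 1 - 1 / real (Suc n)" for n
  proof (induction n)
    case 0
    have "primes_le (Suc 0) = {}" by (auto simp: primes_le_def dest: prime_ge_2_nat)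
    then show ?case by simp
  next
    case (Suc n)
    have "(1 / real (Suc (Suc n))) ^ 2 \<le> 1 / real (Suc n) - 1 / real (Suc (Suc n))"
    proof -
      have "(1 / (x + 1)) ^ 2 \<le> 1 / x - 1 / (x + 1)" if "x > 0" for x :: real
      proof -
        have "1 / ((x + 1) * (x + 1)) \<le> 1 / (x * (x + 1))"
          using that by (intro divide_left_mono mult_right_mono mult_pos_pos) auto
        also have "\<dots> = 1 / x - 1 / (x + 1)" using that by (simp add: field_simps)
        finally show ?thesis by (simp add: power2_eq_square)
      qed
      from this[of "real (Suc n)"] show ?thesis by (simp add: add.commute)
    qed
    moreover have "1 / real (Suc n) - 1 / real (Suc (Suc n)) \<ge> 0" by (simp add: field_simps)
    ultimately show ?case using Suc
      by (subst primes_le_Suc) (auto simp: Suc_notin_primes_le)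
  qed
  moreover have "primes_le 0 = {}" by (auto simp: primes_le_def)
  ultimately show ?thesis
  proof (cases n)
    case (Suc m)
    have "1 - 1 / real (Suc m) \<le> 1" by simp
    then show ?thesis unfolding Suc
      using \<open>(\<Sum>q\<in>primes_le (Suc m). (1 / real q) ^ 2) \<le> 1 - 1 / real (Suc m)\<close> by linarith
  qed simp
qed

text \<open>
  \<open>totient d / d\<close> is least when all primes up to \<open>n\<close> divide \<open>d\<close>; and \<open>ln (1 - 1 / q)\<close> differs from \<open>- 1 / q\<close> by
  a summable amount.
\<close>

lemma totient_ratio_lower:
  obtains c :: real where "c > 0"
    "\<And>d n. d > 0 \<Longrightarrow> n \<ge> 2 \<Longrightarrow> prime_factors d \<subseteq> primes_le n \<Longrightarrow>
       real (totient d) / real d \<ge> c / ln (real n)"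
proof
  let ?C = "5 - ln (ln 2) + 2 :: real"
  show "exp (- ?C) > 0" by simp
  fix d n :: nat assume d: "d > 0" "n \<ge> 2" "prime_factors d \<subseteq> primes_le n"
  have half: "1 / real q \<le> 1 / 2" if "q \<in> primes_le n" for q
    using that prime_ge_2_nat[of q] by (auto simp: primes_le_def field_simps)
  have "exp (- ?C) / ln (real n) = exp (- (ln (ln (real n)) + ?C))"
    using d(2) by (simp add: exp_minus exp_add exp_diff field_simps)
  also have "\<dots> \<le> exp (\<Sum>q\<in>primes_le n. - (1 / real q) - 2 * (1 / real q) ^ 2)"
    using sum_over_primes_le[OF d(2)] sum_inverse_squares_primes_le[of n]
    by (simp add: sum_subtractf sum_negf flip: sum_distrib_left)
  also have "\<dots> = (\<Prod>q\<in>primes_le n. exp (- (1 / real q) - 2 * (1 / real q) ^ 2))"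
    by (simp add: exp_sum)
  also have "\<dots> \<le> (\<Prod>q\<in>primes_le n. 1 - 1 / real q)"
  proof (intro prod_mono conjI)
    fix q assume q: "q \<in> primes_le n"
    have "- (1 / real q) - 2 * (1 / real q) ^ 2 \<le> ln (1 - 1 / real q)"
      using half[OF q] by (intro ln_one_minus_pos_lower_bound) auto
    moreover have "1 - 1 / real q > 0" using half[OF q] by linarith
    ultimately show "exp (- (1 / real q) - 2 * (1 / real q) ^ 2) \<le> 1 - 1 / real q"
      using ln_ge_iff by blast
  qed simp
  also have "\<dots> \<le> (\<Prod>q\<in>prime_factors d. 1 - 1 / real q)"
  proof -
    have "(\<Prod>q\<in>primes_le n. 1 - 1 / real q)
        = (\<Prod>q\<in>primes_le n - prime_factors d. 1 - 1 / real q) * (\<Prod>q\<in>prime_factors d. 1 - 1 / real q)"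
      using d(3) by (intro prod.subset_diff) auto
    also have "\<dots> \<le> 1 * (\<Prod>q\<in>prime_factors d. 1 - 1 / real q)"
    proof (rule mult_right_mono)
      show "(\<Prod>q\<in>primes_le n - prime_factors d. 1 - 1 / real q) \<le> 1"
        using half by (intro prod_le_1) force
      show "0 \<le> (\<Prod>q\<in>prime_factors d. 1 - 1 / real q)"
        using half d(3) by (intro prod_nonneg) force
    qed
    finally show ?thesis by simp
  qed
  also have "\<dots> = real (totient d) / real d" using d(1) by (simp add: totient_formula2)
  finally show "real (totient d) / real d \<ge> exp (- ?C) / ln (real n)" .
qed

text \<open>
  There are at most \<open>ln m / ln y\<close> such prime divisors, because their product does not exceed \<open>m\<close>.
\<close>

lemma sum_inverse_large_prime_factors_le:
  fixes y :: real and m :: nat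
  assumes m: "m > 0" and y: "y > 1"
    and Q: "finite Q" "\<And>q. q \<in> Q \<Longrightarrow> prime q \<and> q dvd m \<and> y \<le> real q"
  shows "(\<Sum>q\<in>Q. 1 / real q) \<le> ln (real m) / (y * ln y)"
proof -
  have "y ^ card Q = (\<Prod>q\<in>Q. y)" by simp
  also have "\<dots> \<le> (\<Prod>q\<in>Q. real q)" using Q(2) y by (intro prod_mono) auto
  also have "\<dots> = real (\<Prod>Q)" by simp
  also have "\<Prod>Q \<le> m" using prod_primes_dvd[OF Q(1)] Q(2) m by (intro dvd_imp_le) auto
  then have "real (\<Prod>Q) \<le> real m" by (simp only: of_nat_le_iff)
  finally have "ln (y ^ card Q) \<le> ln (real m)" using y m by (subst ln_le_cancel_iff) auto
  then have "real (card Q) \<le> ln (real m) / ln y" using y by (simp add: ln_realpow field_simps)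
  then have "real (card Q) * (1 / y) \<le> ln (real m) / ln y * (1 / y)"
    using y by (intro mult_right_mono) auto
  moreover have "(\<Sum>q\<in>Q. 1 / real q) \<le> (\<Sum>q\<in>Q. 1 / y)"
    using Q(2) y by (intro sum_mono divide_left_mono) (auto intro!: mult_pos_pos prime_gt_0_nat)
  ultimately show ?thesis by (simp add: mult.commute)
qed

section \<open>Counting primitive roots\<close>

lemma eventually_size_bounds:
  assumes "C > (0::real)"
  shows "\<forall>\<^sub>F x in at_top. 50 * (x powr (1 / 50) * ln x ^ 2) ^ 33 \<le> x - 1 \<and>
     ln x \<ge> 300 \<and> ln (ln x / 100) \<ge> 2000 \<and> ln (ln x) ^ 3 / ln x \<le> C"
proof (intro eventually_conj)
  show "\<forall>\<^sub>F x::real in at_top. 50 * (x powr (1 / 50) * ln x ^ 2) ^ 33 \<le> x - 1" by real_asymp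
  show "\<forall>\<^sub>F x::real in at_top. ln x \<ge> 300" by real_asymp
  show "\<forall>\<^sub>F x::real in at_top. ln (ln x / 100) \<ge> 2000" by real_asymp
  have "((\<lambda>x::real. ln (ln x) ^ 3 / ln x) \<longlongrightarrow> 0) at_top" by real_asymp
  from order_tendstoD(2)[OF this assms] show "\<forall>\<^sub>F x in at_top. ln (ln x) ^ 3 / ln x \<le> C"
    by eventually_elim simp
qed

text \<open>
  The small primes go up to \<open>y = ln p / 100\<close>, so that \<open>d \<le> 4^y \<le> p powr (1 / 50)\<close> and the condition
  \<open>50 * (d * l)^33 < p\<close> of the sieve holds for \<open>l \<le> (ln p)^2\<close>. On the other hand \<open>y\<close> is large enough for the
  medium primes: \<open>p - 1\<close> has at most \<open>ln p / ln y\<close> prime divisors above \<open>y\<close>, and the sum of their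
  reciprocals is at most \<open>100 / ln y\<close>, which tends to zero.
\<close>

lemma coprime_logs_lower:
  obtains C :: real and P0 :: nat where "C > 0"
    "\<And>p r ind v a \<sigma> X. shifted_logs p r ind v a \<sigma> X \<Longrightarrow> p \<ge> P0 \<Longrightarrow>
       real (card {x \<in> X. \<forall>i<4. coprime (ind (v i x)) (p - 1)}) \<ge> C * (real p / ln (ln (real p)) ^ 4)
       \<and> ln (ln (real p)) > 0"
proof -
  obtain c0 :: real where c0: "c0 > 0"
    "\<And>d n. d > 0 \<Longrightarrow> n \<ge> 2 \<Longrightarrow> prime_factors d \<subseteq> primes_le n \<Longrightarrow> real (totient d) / real d \<ge> c0 / ln (real n)"
    by (rule totient_ratio_lower) blast
  have "c0 ^ 4 / 20 > 0" using c0(1) by simp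
  from eventually_size_bounds[OF this] obtain x0 where x0:
    "\<And>x. x \<ge> x0 \<Longrightarrow> 50 * (x powr (1 / 50) * ln x ^ 2) ^ 33 \<le> x - 1 \<and>
       ln x \<ge> 300 \<and> ln (ln x / 100) \<ge> 2000 \<and> ln (ln x) ^ 3 / ln x \<le> c0 ^ 4 / 20"
    unfolding eventually_at_top_linorder by blast
  show ?thesis
  proof (rule that[of "2 / 5 * c0 ^ 4" "nat \<lceil>x0\<rceil>"])
    show "2 / 5 * c0 ^ 4 > 0" using c0(1) by simp
    fix p r ind v a \<sigma> X
    assume "shifted_logs p r ind v a \<sigma> X" and p_ge: "p \<ge> nat \<lceil>x0\<rceil>"
    then interpret shifted_logs p r ind v a \<sigma> X by simp
    define x where "x = real p"
    have "x \<ge> x0" using p_ge unfolding x_def by linarith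
    from x0[OF this] have size: "50 * (x powr (1 / 50) * ln x ^ 2) ^ 33 \<le> x - 1"
      "ln x \<ge> 300" "ln (ln x / 100) \<ge> 2000" "ln (ln x) ^ 3 / ln x \<le> c0 ^ 4 / 20" by auto
    have p_gt_1: "p > 1" using p by (rule prime_gt_1_nat)
    then have x1: "x > 1" by (simp add: x_def)
    have p_minus_1: "real (p - 1) = x - 1" using p_gt_1 by (simp add: x_def of_nat_diff)
    define y where "y = ln x / 100"
    have y: "y \<ge> 3" using size(2) by (simp add: y_def)
    define n where "n = nat \<lfloor>y\<rfloor>"
    have n: "real n \<le> y" "y < real n + 1" "n \<ge> 2" using y unfolding n_def by linarith+
    define Q where "Q = {q \<in> primes_le n. q dvd p - 1}"
    define d where "d = \<Prod>Q"
    have finQ: "finite Q" by (simp add: Q_def)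
    have Q_prime: "prime q" if "q \<in> Q" for q using that by (simp add: Q_def primes_le_def)
    have d_pos: "d > 0" unfolding d_def by (intro prod_pos prime_gt_0_nat Q_prime)
    have d_dvd: "d dvd p - 1" unfolding d_def by (intro prod_primes_dvd) (auto simp: Q_def primes_le_def)
    have "p > 2" using ln_le_minus_one[of x] x1 size(2) by (simp add: x_def)
    then have "odd p" using prime_odd_nat[OF p] by simp
    then have "2 \<in> Q" using n(3) by (auto simp: Q_def primes_le_def)
    then have "2 dvd d" unfolding d_def using finQ by (rule dvd_prodI[rotated])
    then have d2: "d \<ge> 2" using d_pos by (auto dest: dvd_imp_le)
    have d_le: "real d \<le> x powr (1 / 50)"
    proof -
      have "d dvd \<Prod>(primes_le n)" unfolding d_def by (rule prod_dvd_prod_subset) (auto simp: Q_def)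
      then have "d \<le> \<Prod>(primes_le n)" by (intro dvd_imp_le prod_pos) (auto simp: primes_le_def prime_gt_0_nat)
      also have "\<dots> \<le> 4 ^ n" by (rule primorial_le)
      finally have "real d \<le> real (4 ^ n)" by (simp only: of_nat_le_iff)
      also have "real (4 ^ n) = 4 ^ n" by simp
      also have "(4::real) ^ n \<le> exp 2 ^ n"
      proof (rule power_mono)
        have "(2::real) \<le> exp 1" using exp_ge_add_one_self[of 1] by simp
        then have "(2::real) ^ 2 \<le> exp 1 ^ 2" by (intro power_mono) auto
        then show "(4::real) \<le> exp 2" by (simp flip: exp_of_nat_mult)
      qed simp
      also have "\<dots> = exp (2 * real n)" by (simp flip: exp_of_nat_mult add: mult.commute)
      also have "\<dots> \<le> exp (1 / 50 * ln x)" using n(1) by (simp add: y_def)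
      also have "\<dots> = x powr (1 / 50)" using x1 by (simp add: powr_def)
      finally show ?thesis .
    qed
    have dl: "50 * (d * l) ^ 33 \<le> p - 1" if l: "real l \<le> ln x ^ 2" for l
    proof -
      have "50 * (real d * real l) ^ 33 \<le> 50 * (x powr (1 / 50) * ln x ^ 2) ^ 33"
        using l d_le by (intro mult_left_mono power_mono mult_mono) auto
      also have "\<dots> \<le> real (p - 1)" using size(1) p_minus_1 by simp
      finally have "real (50 * (d * l) ^ 33) \<le> real (p - 1)" by simp
      then show ?thesis by (simp only: of_nat_le_iff)
    qed
    have lnx2: "ln x ^ 2 \<ge> 300 ^ 2" using size(2) by (intro power_mono) auto
    define M where "M = {q. prime q \<and> q dvd p - 1 \<and> n < q \<and> real q \<le> ln x ^ 2}"
    define B where "B = {q. prime q \<and> q dvd p - 1 \<and> ln x ^ 2 < real q}"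
    have p1: "p - 1 > 0" using p_gt_1 by simp
    have finM: "finite M" "finite B"
      using finite_divisors_nat[OF p1] by (auto simp: M_def B_def intro: rev_finite_subset)
    have ln_p1: "ln (real (p - 1)) \<le> ln x" using p1 p_minus_1 by (intro ln_mono) auto
    have sumM: "(\<Sum>q\<in>M. 1 / real q) \<le> 1 / 20"
    proof -
      have "(\<Sum>q\<in>M. 1 / real q) \<le> ln (real (p - 1)) / (y * ln y)"
        using p1 y finM n by (intro sum_inverse_large_prime_factors_le) (auto simp: M_def)
      also have "\<dots> \<le> ln x / (y * ln y)" using ln_p1 y by (intro divide_right_mono) auto
      also have "\<dots> = 100 / ln y" using y size(2) by (simp add: y_def)
      also have "\<dots> \<le> 100 / 2000" using size(3) unfolding y_def[symmetric] by (intro divide_left_mono) auto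
      finally show ?thesis by simp
    qed
    have lnln: "ln (ln x) > 0" using size(2) by simp
    have sumB: "(\<Sum>q\<in>B. 1 / real q) \<le> 1 / (2 * ln x * ln (ln x))"
    proof -
      have "(\<Sum>q\<in>B. 1 / real q) \<le> ln (real (p - 1)) / (ln x ^ 2 * ln (ln x ^ 2))"
        using p1 lnx2 finM by (intro sum_inverse_large_prime_factors_le) (auto simp: B_def)
      also have "\<dots> \<le> ln x / (ln x ^ 2 * ln (ln x ^ 2))" using ln_p1 lnx2 by (intro divide_right_mono) auto
      also have "\<dots> = 1 / (2 * ln x * ln (ln x))"
      proof -
        have "ln (ln x ^ 2) = 2 * ln (ln x)" using size(2) by (simp add: ln_realpow)
        then show ?thesis using size(2) by (simp add: power2_eq_square)
      qed
      finally show ?thesis .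
    qed
    let ?W = "(real (totient d) / real d) ^ 4"
    let ?N = "real (card {x \<in> X. \<forall>i<4. coprime (ind (v i x)) (p - 1)})"
    have N: "?N \<ge> (9 / 10 - 8 * (\<Sum>q\<in>M. 1 / real q)) * ?W * real p - 4 * real p * (\<Sum>q\<in>B. 1 / real q)"
    proof (rule sieve[OF d2 d_dvd _ finM(1) _ finM(2)])
      show "50 * d ^ 33 \<le> p - 1" using dl[of 1] lnx2 by simp
      show "l > 0 \<and> d * l dvd p - 1 \<and> 50 * (d * l) ^ 33 \<le> p - 1" if l: "l \<in> M" for l
      proof -
        have "coprime l d" unfolding d_def
        proof (rule prod_coprime_right)
          fix q assume "q \<in> Q"
          then have "prime q" "q \<noteq> l" using l by (auto simp: Q_def primes_le_def M_def)
          then show "coprime l q" using l by (intro primes_coprime) (auto simp: M_def)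
        qed
        then have "d * l dvd p - 1" using d_dvd l by (intro divides_mult) (auto simp: M_def coprime_commute)
        then show ?thesis using l dl by (auto simp: M_def prime_gt_0_nat)
      qed
      show "l dvd p - 1" if "l \<in> B" for l using that by (simp add: B_def)
      show "l dvd d \<or> l \<in> M \<or> l \<in> B" if l: "prime l" "l dvd p - 1" for l
      proof (cases "l \<le> n")
        case True
        then have "l \<in> Q" using l by (simp add: Q_def primes_le_def)
        then show ?thesis unfolding d_def using finQ by (intro disjI1 dvd_prodI)
      next
        case False
        then show ?thesis using l by (auto simp: M_def B_def)
      qed
    qed
    have W: "?W \<ge> c0 ^ 4 / ln (ln x) ^ 4"
    proof -
      have "prime_factors d \<subseteq> primes_le n"
      proof
        fix q assume "q \<in> prime_factors d"
        then have q: "prime q" "q dvd d" by auto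
        then obtain q' where "q' \<in> Q" "q dvd q'" unfolding d_def using finQ by (auto simp: prime_dvd_prod_iff)
        then have "q = q'" using primes_dvd_imp_eq q(1) Q_prime by blast
        then show "q \<in> primes_le n" using \<open>q' \<in> Q\<close> by (simp add: Q_def)
      qed
      then have "c0 / ln (real n) \<le> real (totient d) / real d" using d_pos n(3) by (intro c0(2))
      moreover have "c0 / ln (ln x) \<le> c0 / ln (real n)"
      proof (intro divide_left_mono)
        have "real n \<le> ln x" using n(1) size(2) by (simp add: y_def)
        then show "ln (real n) \<le> ln (ln x)" using n(3) by (intro ln_mono) auto
        show "0 < ln (ln x) * ln (real n)" using lnln n(3) by simp
      qed (use c0(1) in simp)
      ultimately have "c0 / ln (ln x) \<le> real (totient d) / real d" by linarith
      then have "(c0 / ln (ln x)) ^ 4 \<le> ?W" using c0(1) lnln by (intro power_mono) auto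
      then show ?thesis by (simp add: power_divide)
    qed
    let ?main = "c0 ^ 4 / ln (ln x) ^ 4"
    have "1 / 2 * ?main \<le> (9 / 10 - 8 * (\<Sum>q\<in>M. 1 / real q)) * ?W"
      using sumM W c0(1) lnln by (intro mult_mono) auto
    then have main: "1 / 2 * ?main * x \<le> (9 / 10 - 8 * (\<Sum>q\<in>M. 1 / real q)) * ?W * real p"
      unfolding x_def[symmetric] using x1 by (intro mult_right_mono) auto
    have "4 * (\<Sum>q\<in>B. 1 / real q) \<le> 1 / 10 * ?main"
    proof -
      have "2 / (ln x * ln (ln x)) = 2 * (ln (ln x) ^ 3 / ln x) / ln (ln x) ^ 4"
        using lnln by (simp add: field_simps power_numeral_reduce)
      also have "\<dots> \<le> 2 * (c0 ^ 4 / 20) / ln (ln x) ^ 4"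
        using size(4) lnln by (intro divide_right_mono mult_left_mono) auto
      finally show ?thesis using sumB by simp
    qed
    then have "4 * (\<Sum>q\<in>B. 1 / real q) * x \<le> 1 / 10 * ?main * x" using x1 by (intro mult_right_mono) auto
    then have "4 * real p * (\<Sum>q\<in>B. 1 / real q) \<le> 1 / 10 * ?main * x" by (simp add: x_def mult_ac)
    then have "?N \<ge> 1 / 2 * ?main * x - 1 / 10 * ?main * x" using N main by linarith
    then show "?N \<ge> 2 / 5 * c0 ^ 4 * (real p / ln (ln (real p)) ^ 4) \<and> ln (ln (real p)) > 0"
      using lnln by (simp add: x_def field_simps)
  qed
qed

lemma primroot_tuples_finite: "finite (primroot_tuples a1 a2 a3 p)"
proof (rule finite_subset)
  show "primroot_tuples a1 a2 a3 p \<subseteq> {..<p} \<times> {..<p} \<times> {..<p} \<times> {..<p}"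
    by (auto simp: primroot_tuples_def primitive_roots_def)
qed simp

lemma num_primroot_tuples_lower:
  obtains C :: real and P0 :: nat where "C > 0"
    "\<And>p a1 a2 a3. prime p \<Longrightarrow> p \<ge> P0 \<Longrightarrow> a1 \<in> {0<..<p} \<Longrightarrow> a2 \<in> {0<..<p} \<Longrightarrow> a3 \<in> {0<..<p} \<Longrightarrow>
       a1 \<noteq> a2 \<Longrightarrow> a1 \<noteq> a3 \<Longrightarrow> a2 \<noteq> a3 \<Longrightarrow>
       real (num_primroot_tuples a1 a2 a3 p) \<ge> C * (real p / ln (ln (real p)) ^ 4) \<and> ln (ln (real p)) > 0"
proof -
  obtain C :: real and P0 :: nat where C: "C > 0"
    "\<And>p r ind v a \<sigma> X. shifted_logs p r ind v a \<sigma> X \<Longrightarrow> p \<ge> P0 \<Longrightarrow>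
       real (card {x \<in> X. \<forall>i<4. coprime (ind (v i x)) (p - 1)}) \<ge> C * (real p / ln (ln (real p)) ^ 4)
       \<and> ln (ln (real p)) > 0"
    by (rule coprime_logs_lower) blast
  show ?thesis
  proof (rule that[OF C(1)])
    fix p a1 a2 a3 :: nat
    assume p: "prime p" and large: "p \<ge> P0" and a123: "a1 \<in> {0<..<p}" "a2 \<in> {0<..<p}" "a3 \<in> {0<..<p}"
      "a1 \<noteq> a2" "a1 \<noteq> a3" "a2 \<noteq> a3"
    obtain r ind where logs: "\<not> p dvd r" "inj_on ind {0<..<p}"
      "\<And>x. x \<in> {0<..<p} \<Longrightarrow> ind x < p - 1"
      "\<And>x. x \<in> {0<..<p} \<Longrightarrow> [r ^ ind x = x] (mod p)"
      "\<And>x. x \<in> {0<..<p} \<Longrightarrow> coprime (ind x) (p - 1) \<Longrightarrow> residue_primroot p x"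
      by (rule discrete_log_exists[OF p]) blast
    define a where "a = (\<lambda>i::nat. if i = 0 then 0 else if i = 1 then a1 else if i = 2 then a2 else a3)"
    define v where "v = (\<lambda>(i::nat) x. if i = 0 then x else (a i + (p - x)) mod p)"
    define \<sigma> where "\<sigma> = (\<lambda>i::nat. if i = 0 then 1 else -1 :: int)"
    define X where "X = {..<p} - a ` {..<4}"
    have a_less: "a i < p" for i using a123 by (simp add: a_def)
    have v_range: "v i x \<in> {0<..<p}" if x: "x \<in> X" and i: "i < 4" for i x
    proof (cases "i = 0")
      case True
      have "x \<noteq> a 0" using x by (auto simp: X_def)
      then show ?thesis using x True by (auto simp: v_def X_def a_def)
    next
      case False
      have xa: "x \<noteq> a i" "x < p" using x i by (auto simp: X_def)
      have "\<not> p dvd a i + (p - x)"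
      proof
        assume "p dvd a i + (p - x)"
        then obtain k where k: "a i + (p - x) = p * k" by (elim dvdE)
        have "0 < p * k" "p * k < p * 2" using k xa a_less[of i] by linarith+
        then have "k = 1" by simp
        then show False using k xa by simp
      qed
      then show ?thesis using xa False by (simp add: v_def mod_greater_zero_iff_not_dvd)
    qed
    interpret shifted_logs p r ind v a \<sigma> X
    proof
      show "inj_on a {..<4}"
      proof (rule inj_onI)
        fix i j assume "i \<in> {..<4::nat}" "j \<in> {..<4::nat}" and e: "a i = a j"
        then have "i = 0 \<or> i = 1 \<or> i = 2 \<or> i = 3" "j = 0 \<or> j = 1 \<or> j = 2 \<or> j = 3" by auto
        then show "i = j" using e a123 by (auto simp: a_def)
      qed
      show "[int (v i x) = \<sigma> i * (int x - int (a i))] (mod int p)" if x: "x \<in> X" and i: "i < 4" for i x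
      proof (cases "i = 0")
        case False
        have "x < p" using x by (simp add: X_def)
        then have "int (a i + (p - x)) - (int (a i) - int x) = int p" by simp
        then have "[int (a i + (p - x)) = int (a i) - int x] (mod int p)"
          by (simp only: cong_iff_dvd_diff dvd_refl)
        then have "[int ((a i + (p - x)) mod p) = int (a i) - int x] (mod int p)"
          by (simp only: zmod_int cong_mod_left)
        then show ?thesis using False by (simp add: v_def \<sigma>_def)
      qed (simp add: v_def \<sigma>_def a_def)
      show "\<sigma> i \<in> {1, -1}" for i by (simp add: \<sigma>_def)
    qed (use p logs v_range a_less in \<open>auto simp: X_def\<close>)
    let ?G = "{x \<in> X. \<forall>i<4. coprime (ind (v i x)) (p - 1)}"
    have "card ?G \<le> card (primroot_tuples a1 a2 a3 p)"
    proof (rule card_inj_on_le[where f = "\<lambda>x. (v 1 x, v 2 x, v 3 x, x)"])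
      show "inj_on (\<lambda>x. (v 1 x, v 2 x, v 3 x, x)) ?G" by (auto simp: inj_on_def)
      show "(\<lambda>x. (v 1 x, v 2 x, v 3 x, x)) ` ?G \<subseteq> primroot_tuples a1 a2 a3 p"
      proof clarify
        fix x assume x: "x \<in> X" "\<forall>i<4. coprime (ind (v i x)) (p - 1)"
        have prim: "v i x \<in> primitive_roots p" if "i < 4" for i
          using v_range[OF x(1) that] logs(5) x(2) that by (auto simp: primitive_roots_def)
        have sum: "[v i x + x = a i] (mod p)" if "i \<noteq> 0" for i
        proof -
          have "x < p" using x by (simp add: X_def)
          then have "a i + (p - x) + x = a i + p" by simp
          then have "[a i + (p - x) + x = a i] (mod p)" by (simp only: cong_add_lcancel_0_nat cong_0_iff dvd_refl)
          then have "[(a i + (p - x)) mod p + x = a i] (mod p)"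
            by (simp only: unique_euclidean_semiring_class.cong_def mod_add_left_eq)
          then show ?thesis using that by (simp add: v_def)
        qed
        show "(v 1 x, v 2 x, v 3 x, x) \<in> primroot_tuples a1 a2 a3 p"
          using prim[of 0] prim[of 1] prim[of 2] prim[of 3] sum[of 1] sum[of 2] sum[of 3]
          by (simp add: primroot_tuples_def a_def v_def)
      qed
    qed (rule primroot_tuples_finite)
    then have "real (card ?G) \<le> real (num_primroot_tuples a1 a2 a3 p)" by (simp add: num_primroot_tuples_def)
    moreover have "real (card ?G) \<ge> C * (real p / ln (ln (real p)) ^ 4) \<and> ln (ln (real p)) > 0"
      using shifted_logs_axioms large by (rule C(2))
    ultimately show "real (num_primroot_tuples a1 a2 a3 p) \<ge> C * (real p / ln (ln (real p)) ^ 4) \<and> ln (ln (real p)) > 0"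
      by linarith
  qed
qed

theorem mainTheorem2:
  shows "(\<exists>c::real. c > 0 \<and> (\<exists>p0::nat. \<forall>p::nat. prime p \<longrightarrow> p \<ge> p0 \<longrightarrow>
            (\<forall>a1\<in>{0<..<p}. \<forall>a2\<in>{0<..<p}. \<forall>a3\<in>{0<..<p}.
               a1 \<noteq> a2 \<longrightarrow> a1 \<noteq> a3 \<longrightarrow> a2 \<noteq> a3 \<longrightarrow>
               real (num_primroot_tuples a1 a2 a3 p) \<ge> c * (real p / (ln (ln (real p))) ^ 4))))
       \<and> (\<exists>p1::nat. \<forall>p::nat. prime p \<longrightarrow> p \<ge> p1 \<longrightarrow>
            (\<forall>a\<in>{0<..<p}. \<forall>b\<in>{0<..<p}. \<forall>c'\<in>{0<..<p}.
               a \<noteq> b \<longrightarrow> a \<noteq> c' \<longrightarrow> b \<noteq> c' \<longrightarrow>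
               (\<exists>\<alpha>\<in>primitive_roots p. \<exists>\<beta>\<in>primitive_roots p.
                \<exists>\<gamma>\<in>primitive_roots p. \<exists>\<delta>\<in>primitive_roots p.
                  [\<alpha> + \<delta> = a] (mod p) \<and> [\<beta> + \<delta> = b] (mod p) \<and> [\<gamma> + \<delta> = c'] (mod p))))"
proof -
  obtain C :: real and P0 :: nat where C: "C > 0"
    "\<And>p a1 a2 a3. prime p \<Longrightarrow> p \<ge> P0 \<Longrightarrow> a1 \<in> {0<..<p} \<Longrightarrow> a2 \<in> {0<..<p} \<Longrightarrow> a3 \<in> {0<..<p} \<Longrightarrow>
       a1 \<noteq> a2 \<Longrightarrow> a1 \<noteq> a3 \<Longrightarrow> a2 \<noteq> a3 \<Longrightarrow>
       real (num_primroot_tuples a1 a2 a3 p) \<ge> C * (real p / ln (ln (real p)) ^ 4) \<and> ln (ln (real p)) > 0"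
    by (rule num_primroot_tuples_lower) blast
  have "\<exists>\<alpha>\<in>primitive_roots p. \<exists>\<beta>\<in>primitive_roots p. \<exists>\<gamma>\<in>primitive_roots p. \<exists>\<delta>\<in>primitive_roots p.
      [\<alpha> + \<delta> = a] (mod p) \<and> [\<beta> + \<delta> = b] (mod p) \<and> [\<gamma> + \<delta> = c'] (mod p)"
    if "prime p" "p \<ge> P0" "a \<in> {0<..<p}" "b \<in> {0<..<p}" "c' \<in> {0<..<p}" "a \<noteq> b" "a \<noteq> c'" "b \<noteq> c'"
    for p a b c' :: nat
  proof -
    have "C * (real p / ln (ln (real p)) ^ 4) > 0"
      using C(1) C(2)[OF that] prime_gt_0_nat[OF that(1)] by simp
    then have "card (primroot_tuples a b c' p) > 0"
      using C(2)[OF that] by (simp add: num_primroot_tuples_def)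
    then obtain t where "t \<in> primroot_tuples a b c' p" by (metis card_gt_0_iff ex_in_conv)
    then show ?thesis unfolding primroot_tuples_def by blast
  qed
  then show ?thesis using C by (intro conjI exI[of _ C] exI[of _ P0]) blast+
qed

end
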